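(* Let $n\in\mathbb{N}$ and let $B$ be a unital algebra. Then the map $$\chi:\operatorname{Ext}(\mathbb{Z}^n,B)\to H^2(\mathbb{Z}^n,B),\qquad [A]\mapsto\chi(A)$$ is a well-defined bijection.
   Context: Algebras are associative (over a fixed field, $\mathbb{C}$ in the paper). Algebraically trivial NCP $\mathbb{T}^n$-bundles: a $\mathbb{Z}^n$-graded unital associative algebra $A=\bigoplus_{{\bf k}\in\mathbb{Z}^n}A_{\bf k}$ with $A_{\bf 0}=B$ such that each grading space $A_{\bf k}$ contains an invertible element of $A$ is called an algebraically trivial NCP $\mathbb{T}^n$-bundle with base $B$. Two such algebras $A,A'$ with base $B$ are equivalent if there is an algebra isomorphism $\varphi:A\to A'$ with $\varphi(A_{\bf k})=A'_{\bf k}$ for all ${\bf k}$ and $\varphi|_B=\operatorname{id}_B$. $\operatorname{Ext}(\mathbb{Z}^n,B)$ is the set of equivalence classes. Cohomology: $B^\times$ is the unit group of $B$ and $C_B:B^\times\to\operatorname{Aut}(B)$, $C_B(u)(b)=ubu^{-1}$. $C^1(\mathbb{Z}^n,\operatorname{Aut}(B))$, $C^1(\mathbb{Z}^n,B^\times)$ and $C^2(\mathbb{Z}^n,B^\times)$ denote the normalized maps ($S({\bf 0})=\operatorname{id}_B$, $h({\bf 0})=1_B$, $\omega({\bf k},{\bf 0})=\omega({\bf 0},{\bf k})=1_B$). For $S\in C^1(\mathbb{Z}^n,\operatorname{Aut}(B))$ put $\delta_S({\bf k},{\bf l}):=S({\bf k})S({\bf l})S({\bf k}+{\bf l})^{-1}$,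 and for $\omega\in C^2(\mathbb{Z}^n,B^\times)$ put $(d_S\omega)({\bf k},{\bf l},{\bf m}):=S({\bf k})(\omega({\bf l},{\bf m}))\,\omega({\bf k},{\bf l}+{\bf m})\,\omega({\bf k}+{\bf l},{\bf m})^{-1}\omega({\bf k},{\bf l})^{-1}$. Factor systems are the elements of $$Z^2(\mathbb{Z}^n,B):=\{(S,\omega)\in C^1(\mathbb{Z}^n,\operatorname{Aut}(B))\times C^2(\mathbb{Z}^n,B^\times):\ \delta_S=C_B\circ\omega,\ d_S\omega=1_B\}.$$ The group $C^1(\mathbb{Z}^n,B^\times)$ (pointwise multiplication) acts on $Z^2(\mathbb{Z}^n,B)$ by $h.(S,\omega):=((C_B\circ h)\cdot S,\ h\ast_S\omega)$ with $(h\ast_S\omega)({\bf k},{\bf l}):=h({\bf k})\,S({\bf k})(h({\bf l}))\,\omega({\bf k},{\bf l})\,h({\bf k}+{\bf l})^{-1}$, and $H^2(\mathbb{Z}^n,B):=Z^2(\mathbb{Z}^n,B)/C^1(\mathbb{Z}^n,B^\times)$ is the orbit set. Characteristic class: for an algebraically trivial NCP $\mathbb{T}^n$-bundle $A$ with base $B$, the set $A_h^\times:=\bigcup_{\bf k}(A_{\bf k}\cap A^\times)$ is a group and $1\to B^\times\to A_h^\times\to\mathbb{Z}^n\to1$ is an extension of groups. Choose a section $\sigma:\mathbb{Z}^n\to A_h^\times$ with $\sigma({\bf 0})=1_A$, and put $S({\bf k})(b):=\sigma({\bf k})b\sigma({\bf k})^{-1}$, $\omega({\bf k},{\bf l}):=\sigma({\bf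 k})\sigma({\bf l})\sigma({\bf k}+{\bf l})^{-1}$. Then $\chi(A):=[(S,\omega)]\in H^2(\mathbb{Z}^n,B)$, which is independent of the choice of $\sigma$. *)

theory Defs
  imports "HOL-Algebra.Module" "HOL-Algebra.Bij" "HOL-Algebra.Product_Groups"
begin

section \<open>Unital associative algebras\<close>

text \<open>The locale \<open>algebra\<close> of the library is restricted to commutative algebras.\<close>

locale unital_algebra = module K A + ring A for K and A (structure) +
  assumes smult_mult_left:
      "\<lbrakk>a \<in> carrier K; x \<in> carrier A; y \<in> carrier A\<rbrakk>
        \<Longrightarrow> (a \<odot> x) \<otimes> y = a \<odot> (x \<otimes> y)"
    and smult_mult_right:
      "\<lbrakk>a \<in> carrier K; x \<in> carrier A; y \<in> carrier A\<rbrakk>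
        \<Longrightarrow> x \<otimes> (a \<odot> y) = a \<odot> (x \<otimes> y)"

definition alg_hom ::
    "('k, 'm) ring_scheme \<Rightarrow> ('k, 'a, 'x) module_scheme \<Rightarrow> ('k, 'b, 'y) module_scheme
      \<Rightarrow> ('a \<Rightarrow> 'b) set" where
  "alg_hom K A B = {\<phi> \<in> ring_hom A B.
     \<forall>a \<in> carrier K. \<forall>x \<in> carrier A. \<phi> (a \<odot>\<^bsub>A\<^esub> x) = a \<odot>\<^bsub>B\<^esub> \<phi> x}"

text \<open>
  The automorphism group of an algebra, in the same style as \<open>AutoGroup\<close>: its elements are
  extensional on the carrier of \<open>B\<close>, and multiplication is composition.
\<close>

definition alg_AutGroup ::
    "('k, 'm) ring_scheme \<Rightarrow> ('k, 'b, 'y) module_scheme \<Rightarrow> ('b \<Rightarrow> 'b) monoid" where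
  "alg_AutGroup K B =
     BijGroup (carrier B) \<lparr>carrier := alg_hom K B B \<inter> Bij (carrier B)\<rparr>"

definition conj_aut :: "('b, 'y) ring_scheme \<Rightarrow> 'b \<Rightarrow> 'b \<Rightarrow> 'b" where
  "conj_aut B u = (\<lambda>b \<in> carrier B. u \<otimes>\<^bsub>B\<^esub> b \<otimes>\<^bsub>B\<^esub> inv\<^bsub>B\<^esub> u)"


section \<open>Factor systems and the second cohomology\<close>

text \<open>
  \<open>\<int>\<^sup>n\<close> as a multiplicatively written group record; \<open>n = 0\<close> gives the trivial group.  The
  definitions below are given for an arbitrary group record \<open>G\<close> in place of \<open>\<int>\<^sup>n\<close>.
\<close>

definition Zn :: "nat \<Rightarrow> (nat \<Rightarrow> int) monoid" where
  "Zn n = product_group {..<n} (\<lambda>_. integer_group)"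

text \<open>
  Normalized cochains with values in \<open>H\<close>.  Cochains are extensional, so that equality of cochains
  means equality on the carrier of \<open>G\<close>.
\<close>

definition cochains1 :: "('g, 'q) monoid_scheme \<Rightarrow> ('h, 'r) monoid_scheme \<Rightarrow> ('g \<Rightarrow> 'h) set" where
  "cochains1 G H = {f \<in> carrier G \<rightarrow>\<^sub>E carrier H. f \<one>\<^bsub>G\<^esub> = \<one>\<^bsub>H\<^esub>}"

definition cochains2 ::
    "('g, 'q) monoid_scheme \<Rightarrow> ('h, 'r) monoid_scheme \<Rightarrow> ('g \<times> 'g \<Rightarrow> 'h) set" where
  "cochains2 G H = {\<omega> \<in> carrier G \<times> carrier G \<rightarrow>\<^sub>E carrier H.
     \<forall>k \<in> carrier G. \<omega> (k, \<one>\<^bsub>G\<^esub>) = \<one>\<^bsub>H\<^esub> \<and> \<omega> (\<one>\<^bsub>G\<^esub>, k) = \<one>\<^bsub>H\<^esub>}"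

definition curvature ::
    "('k, 'm) ring_scheme \<Rightarrow> ('g, 'q) monoid_scheme \<Rightarrow> ('k, 'b, 'y) module_scheme
      \<Rightarrow> ('g \<Rightarrow> 'b \<Rightarrow> 'b) \<Rightarrow> 'g \<Rightarrow> 'g \<Rightarrow> 'b \<Rightarrow> 'b" where
  "curvature K G B S k l =
     S k \<otimes>\<^bsub>alg_AutGroup K B\<^esub> S l
       \<otimes>\<^bsub>alg_AutGroup K B\<^esub> inv\<^bsub>alg_AutGroup K B\<^esub> (S (k \<otimes>\<^bsub>G\<^esub> l))"

definition twisted_coboundary ::
    "('g, 'q) monoid_scheme \<Rightarrow> ('b, 'y) ring_scheme
      \<Rightarrow> ('g \<Rightarrow> 'b \<Rightarrow> 'b) \<Rightarrow> ('g \<times> 'g \<Rightarrow> 'b) \<Rightarrow> 'g \<Rightarrow> 'g \<Rightarrow> 'g \<Rightarrow> 'b" where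
  "twisted_coboundary G B S \<omega> k l m =
     S k (\<omega> (l, m)) \<otimes>\<^bsub>B\<^esub> \<omega> (k, l \<otimes>\<^bsub>G\<^esub> m)
       \<otimes>\<^bsub>B\<^esub> inv\<^bsub>B\<^esub> \<omega> (k \<otimes>\<^bsub>G\<^esub> l, m) \<otimes>\<^bsub>B\<^esub> inv\<^bsub>B\<^esub> \<omega> (k, l)"

definition factor_systems ::
    "('k, 'm) ring_scheme \<Rightarrow> ('g, 'q) monoid_scheme \<Rightarrow> ('k, 'b, 'y) module_scheme
      \<Rightarrow> (('g \<Rightarrow> 'b \<Rightarrow> 'b) \<times> ('g \<times> 'g \<Rightarrow> 'b)) set" where
  "factor_systems K G B =
     {(S, \<omega>). S \<in> cochains1 G (alg_AutGroup K B) \<and> \<omega> \<in> cochains2 G (units_of B) \<and>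
       (\<forall>k \<in> carrier G. \<forall>l \<in> carrier G.
          curvature K G B S k l = conj_aut B (\<omega> (k, l))) \<and>
       (\<forall>k \<in> carrier G. \<forall>l \<in> carrier G. \<forall>m \<in> carrier G.
          twisted_coboundary G B S \<omega> k l m = \<one>\<^bsub>B\<^esub>)}"

fun cochain_act ::
    "('k, 'm) ring_scheme \<Rightarrow> ('g, 'q) monoid_scheme \<Rightarrow> ('k, 'b, 'y) module_scheme \<Rightarrow> ('g \<Rightarrow> 'b)
      \<Rightarrow> ('g \<Rightarrow> 'b \<Rightarrow> 'b) \<times> ('g \<times> 'g \<Rightarrow> 'b) \<Rightarrow> ('g \<Rightarrow> 'b \<Rightarrow> 'b) \<times> ('g \<times> 'g \<Rightarrow> 'b)" where
  "cochain_act K G B h (S, \<omega>) =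
     (\<lambda>k \<in> carrier G. conj_aut B (h k) \<otimes>\<^bsub>alg_AutGroup K B\<^esub> S k,
      \<lambda>(k, l) \<in> carrier G \<times> carrier G.
        h k \<otimes>\<^bsub>B\<^esub> S k (h l) \<otimes>\<^bsub>B\<^esub> \<omega> (k, l) \<otimes>\<^bsub>B\<^esub> inv\<^bsub>B\<^esub> h (k \<otimes>\<^bsub>G\<^esub> l))"

definition cohomology_class ::
    "('k, 'm) ring_scheme \<Rightarrow> ('g, 'q) monoid_scheme \<Rightarrow> ('k, 'b, 'y) module_scheme
      \<Rightarrow> ('g \<Rightarrow> 'b \<Rightarrow> 'b) \<times> ('g \<times> 'g \<Rightarrow> 'b)
      \<Rightarrow> (('g \<Rightarrow> 'b \<Rightarrow> 'b) \<times> ('g \<times> 'g \<Rightarrow> 'b)) set" where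
  "cohomology_class K G B s = (\<lambda>h. cochain_act K G B h s) ` cochains1 G (units_of B)"

definition H2 ::
    "('k, 'm) ring_scheme \<Rightarrow> ('g, 'q) monoid_scheme \<Rightarrow> ('k, 'b, 'y) module_scheme
      \<Rightarrow> (('g \<Rightarrow> 'b \<Rightarrow> 'b) \<times> ('g \<times> 'g \<Rightarrow> 'b)) set set" where
  "H2 K G B = cohomology_class K G B ` factor_systems K G B"


section \<open>Algebraically trivial bundles\<close>

text \<open>
  A bundle with base \<open>B\<close> is an algebra \<open>A\<close> together with its grading spaces and the identification
  \<open>base_emb\<close> of \<open>B\<close> with the grading space of the neutral element; the map \<open>base_emb\<close> makes it
  possible for \<open>A\<close> and \<open>B\<close> to have elements of different types.
\<close>

record ('k, 'a, 'g, 'b) ncp_bundle = "('k, 'a) module" +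
  grade :: "'g \<Rightarrow> 'a set"
  base_emb :: "'b \<Rightarrow> 'a"

text \<open>
  In the condition \<open>direct_sum\<close>, the function \<open>f\<close> is the family of homogeneous components of \<open>x\<close>.
\<close>

locale trivial_bundle = unital_algebra K A
  for K and G :: "('g, 'q) monoid_scheme" and B :: "('k, 'b, 'y) module_scheme"
    and A :: "('k, 'a, 'g, 'b) ncp_bundle" (structure) +
  assumes grade_subspace: "k \<in> carrier G \<Longrightarrow> submodule (grade A k) K A"
    and grade_mult:
      "\<lbrakk>k \<in> carrier G; l \<in> carrier G; x \<in> grade A k; y \<in> grade A l\<rbrakk>
        \<Longrightarrow> x \<otimes> y \<in> grade A (k \<otimes>\<^bsub>G\<^esub> l)"
    and direct_sum:
      "x \<in> carrier A \<Longrightarrow>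
        \<exists>!f. f \<in> (\<Pi>\<^sub>E k \<in> carrier G. grade A k) \<and> finite {k \<in> carrier G. f k \<noteq> \<zero>} \<and>
          x = (\<Oplus>k \<in> {k \<in> carrier G. f k \<noteq> \<zero>}. f k)"
    and base_hom: "base_emb A \<in> alg_hom K B A"
    and base_bij: "bij_betw (base_emb A) (carrier B) (grade A \<one>\<^bsub>G\<^esub>)"
    and invertible: "k \<in> carrier G \<Longrightarrow> grade A k \<inter> Units A \<noteq> {}"

definition trivial_bundles ::
    "('k, 'm) ring_scheme \<Rightarrow> ('g, 'q) monoid_scheme \<Rightarrow> ('k, 'b, 'y) module_scheme
      \<Rightarrow> ('k, 'a, 'g, 'b) ncp_bundle set" where
  "trivial_bundles K G B = {A. trivial_bundle K G B A}"

definition bundle_rel ::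
    "('k, 'm) ring_scheme \<Rightarrow> ('g, 'q) monoid_scheme \<Rightarrow> ('k, 'b, 'y) module_scheme
      \<Rightarrow> ('k, 'a, 'g, 'b) ncp_bundle rel" where
  "bundle_rel K G B =
     {(A, A'). A \<in> trivial_bundles K G B \<and> A' \<in> trivial_bundles K G B \<and>
       (\<exists>\<phi> \<in> alg_hom K A A'. bij_betw \<phi> (carrier A) (carrier A') \<and>
          (\<forall>k \<in> carrier G. \<phi> ` grade A k = grade A' k) \<and>
          (\<forall>b \<in> carrier B. \<phi> (base_emb A b) = base_emb A' b))}"

definition Ext ::
    "('k, 'm) ring_scheme \<Rightarrow> ('g, 'q) monoid_scheme \<Rightarrow> ('k, 'b, 'y) module_scheme
      \<Rightarrow> ('k, 'a, 'g, 'b) ncp_bundle set set" where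
  "Ext K G B = trivial_bundles K G B // bundle_rel K G B"

text \<open>
  Finitely supported families in \<open>B\<close>.  Choosing an invertible element in each grading space
  identifies the elements of a bundle with these families, so a type can carry a bundle with base
  \<open>B\<close> if and only if this set injects into it.
\<close>

definition finsupp_families ::
    "('g, 'q) monoid_scheme \<Rightarrow> ('b, 'y) ring_scheme \<Rightarrow> ('g \<Rightarrow> 'b) set" where
  "finsupp_families G B =
     {f \<in> carrier G \<rightarrow>\<^sub>E carrier B. finite {k \<in> carrier G. f k \<noteq> \<zero>\<^bsub>B\<^esub>}}"


section \<open>The characteristic class\<close>

definition homogeneous_sections ::
    "('g, 'q) monoid_scheme \<Rightarrow> ('k, 'a, 'g, 'b) ncp_bundle \<Rightarrow> ('g \<Rightarrow> 'a) set" where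
  "homogeneous_sections G A =
     {\<sigma> \<in> (\<Pi>\<^sub>E k \<in> carrier G. grade A k \<inter> Units A). \<sigma> \<one>\<^bsub>G\<^esub> = \<one>\<^bsub>A\<^esub>}"

text \<open>The inverse of \<open>base_emb\<close> reads elements of the neutral grading space as elements of \<open>B\<close>.\<close>

definition section_factor_system ::
    "('g, 'q) monoid_scheme \<Rightarrow> ('k, 'b, 'y) module_scheme \<Rightarrow> ('k, 'a, 'g, 'b) ncp_bundle
      \<Rightarrow> ('g \<Rightarrow> 'a) \<Rightarrow> ('g \<Rightarrow> 'b \<Rightarrow> 'b) \<times> ('g \<times> 'g \<Rightarrow> 'b)" where
  "section_factor_system G B A \<sigma> =
     (\<lambda>k \<in> carrier G. \<lambda>b \<in> carrier B.
        inv_into (carrier B) (base_emb A) (\<sigma> k \<otimes>\<^bsub>A\<^esub> base_emb A b \<otimes>\<^bsub>A\<^esub> inv\<^bsub>A\<^esub> \<sigma> k),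
      \<lambda>(k, l) \<in> carrier G \<times> carrier G.
        inv_into (carrier B) (base_emb A) (\<sigma> k \<otimes>\<^bsub>A\<^esub> \<sigma> l \<otimes>\<^bsub>A\<^esub> inv\<^bsub>A\<^esub> \<sigma> (k \<otimes>\<^bsub>G\<^esub> l)))"

definition char_class ::
    "('k, 'm) ring_scheme \<Rightarrow> ('g, 'q) monoid_scheme \<Rightarrow> ('k, 'b, 'y) module_scheme
      \<Rightarrow> ('k, 'a, 'g, 'b) ncp_bundle \<Rightarrow> (('g \<Rightarrow> 'b \<Rightarrow> 'b) \<times> ('g \<times> 'g \<Rightarrow> 'b)) set" where
  "char_class K G B A = cohomology_class K G B
     (section_factor_system G B A (SOME \<sigma>. \<sigma> \<in> homogeneous_sections G A))"

text \<open>
  The map induced by \<open>char_class\<close> on equivalence classes; it is meaningful as soon as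
  \<open>char_class\<close> is constant on them.
\<close>

definition chi ::
    "('k, 'm) ring_scheme \<Rightarrow> ('g, 'q) monoid_scheme \<Rightarrow> ('k, 'b, 'y) module_scheme
      \<Rightarrow> ('k, 'a, 'g, 'b) ncp_bundle set \<Rightarrow> (('g \<Rightarrow> 'b \<Rightarrow> 'b) \<times> ('g \<times> 'g \<Rightarrow> 'b)) set" where
  "chi K G B X = the_elem (char_class K G B ` X)"

end

theory Submission
  imports Defs
begin

text \<open>
  Let \<open>G\<close> be the grading group.  A homogeneous section \<open>\<sigma>\<close> of a bundle \<open>A\<close> makes every element of \<open>A\<close> a
  unique finite sum of terms \<open>b \<sigma>(k)\<close> with coefficients \<open>b\<close> in \<open>B\<close>, and the product of such sums is
  determined by the two relations
  \<open>\<sigma>(k) b = S(k)(b) \<sigma>(k)\<close> and \<open>\<sigma>(k) \<sigma>(l) = \<omega>(k, l) \<sigma>(k l)\<close>,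
  where \<open>(S, \<omega>)\<close> is the factor system of \<open>\<sigma>\<close>.  So, up to isomorphism, a bundle with a section is the
  same thing as a factor system, and the theorem says what remains of this when the section is forgotten.

  In one direction, associativity of \<open>A\<close>, applied to \<open>\<sigma>(k) \<sigma>(l) b\<close> and \<open>\<sigma>(k) \<sigma>(l) \<sigma>(m)\<close>, is the
  curvature condition and the cocycle identity for \<open>(S, \<omega>)\<close>
  (\<open>section_factor_system_in_factor_systems\<close>).  Two sections differ by a unique cochain with values in
  the units of \<open>B\<close>, and replacing \<open>\<sigma>\<close> by \<open>h \<sigma>\<close> changes the factor system by the action of \<open>h\<close>.  Hence the
  cohomology class of one factor system of \<open>A\<close> is the set of the factor systems of all sections of \<open>A\<close>
  (\<open>cohomology_class_section_factor_system\<close>).  This description of \<open>\<chi>(A)\<close> involves no choice of a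
  section.  Since an isomorphism of bundles carries sections to sections with the same factor system,
  \<open>\<chi>\<close> is constant on equivalence classes.

  In the other direction, the two relations define a product on the finitely supported families in \<open>B\<close>,
  and the conditions on a factor system make it associative.  This is the crossed product; it is a
  bundle with a section whose factor system is the given one
  (\<open>crossed_product_trivial_bundle\<close>, \<open>crossed_product_section\<close>), which gives surjectivity of \<open>\<chi>\<close>.  The
  hypothesis \<open>large_universe\<close> serves to carry the crossed product over to the element type \<open>'a\<close>
  (\<open>bundle_transport\<close>).  Moreover, every bundle with a section is isomorphic to the crossed product by
  the factor system of that section (\<open>crossed_product_iso\<close>).  If \<open>\<chi>(A) = \<chi>(A')\<close>, then \<open>A\<close> and \<open>A'\<close> have
  sections with a common factor system, so both are isomorphic to the same crossed product; this is
  injectivity.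
\<close>

section \<open>Homogeneous components\<close>

lemma finsum_additive:
  assumes "abelian_group M" "abelian_group N" "h \<in> carrier M \<rightarrow> carrier N"
    and add: "\<And>x y. \<lbrakk>x \<in> carrier M; y \<in> carrier M\<rbrakk> \<Longrightarrow> h (x \<oplus>\<^bsub>M\<^esub> y) = h x \<oplus>\<^bsub>N\<^esub> h y"
    and "f \<in> I \<rightarrow> carrier M"
  shows "h (finsum M f I) = finsum N (\<lambda>i. h (f i)) I"
proof -
  interpret M: abelian_group M by fact
  interpret N: abelian_group N by fact
  have h: "h x \<in> carrier N" if "x \<in> carrier M" for x
    using assms(3) that by auto
  have zero: "h \<zero>\<^bsub>M\<^esub> = \<zero>\<^bsub>N\<^esub>"
    using add[of "\<zero>\<^bsub>M\<^esub>" "\<zero>\<^bsub>M\<^esub>"] h[of "\<zero>\<^bsub>M\<^esub>"] by (metis M.r_zero M.zero_closed N.add.l_cancel_one)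
  show ?thesis
    using assms(5)
  proof (induction I rule: infinite_finite_induct)
    case (insert i I)
    then show ?case
      by (subst M.finsum_insert N.finsum_insert; auto simp: Pi_iff h add M.finsum_closed)+
  qed (auto simp: zero)
qed

locale bundle_base = G: group G + B: unital_algebra K B
  for K :: "('k, 'm) ring_scheme" and G :: "('g, 'q) monoid_scheme"
    and B :: "('k, 'b, 'y) module_scheme" (structure)

locale graded_bundle = bundle_base K G B + A: trivial_bundle K G B A
  for K :: "('k, 'm) ring_scheme" and G :: "('g, 'q) monoid_scheme"
    and B :: "('k, 'b, 'y) module_scheme" and A :: "('k, 'a, 'g, 'b) ncp_bundle" (structure)
begin

lemma grade_closed: "k \<in> carrier G \<Longrightarrow> x \<in> grade A k \<Longrightarrow> x \<in> carrier A"
  using A.submoduleE(1)[OF A.grade_subspace] by blast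

lemma grade_add: "k \<in> carrier G \<Longrightarrow> x \<in> grade A k \<Longrightarrow> y \<in> grade A k \<Longrightarrow> x \<oplus> y \<in> grade A k"
  using A.submoduleE(5)[OF A.grade_subspace] by blast

lemma grade_zero: "k \<in> carrier G \<Longrightarrow> \<zero> \<in> grade A k"
  using subgroup.one_closed[OF submodule.axioms(1)[OF A.grade_subspace]] by simp

abbreviation "decomposes x f \<equiv> f \<in> (\<Pi>\<^sub>E k \<in> carrier G. grade A k)
  \<and> finite {k \<in> carrier G. f k \<noteq> \<zero>} \<and> x = (\<Oplus>k \<in> {k \<in> carrier G. f k \<noteq> \<zero>}. f k)"

definition component :: "'a \<Rightarrow> 'g \<Rightarrow> 'a" where
  "component x = (THE f. decomposes x f)"

lemma decomposes_component:
  assumes "x \<in> carrier A"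
  shows "decomposes x (component x)"
  unfolding component_def by (rule theI'[OF A.direct_sum[OF assms]])

lemma component_in_grade: "x \<in> carrier A \<Longrightarrow> k \<in> carrier G \<Longrightarrow> component x k \<in> grade A k"
  using decomposes_component[of x] by (blast dest: PiE_mem)

text \<open>
  By uniqueness of the decomposition, any finite sum of homogeneous terms of distinct degrees is
  already the decomposition of its value.  All components below are computed in this way.
\<close>
lemma component_sum:
  assumes "finite F" "F \<subseteq> carrier G" and y: "\<And>l. l \<in> F \<Longrightarrow> y l \<in> grade A l" and "k \<in> carrier G"
  shows "component (\<Oplus>l \<in> F. y l) k = (if k \<in> F then y k else \<zero>)"
proof -
  let ?x = "\<Oplus>l \<in> F. y l"
  let ?f = "\<lambda>l \<in> carrier G. if l \<in> F then y l else \<zero>"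
  have yc: "l \<in> F \<Longrightarrow> y l \<in> carrier A" for l
    using y assms(2) grade_closed by blast
  have x: "?x \<in> carrier A"
    by (rule A.finsum_closed) (auto simp: yc)
  have supp: "{l \<in> carrier G. ?f l \<noteq> \<zero>} = {l \<in> F. y l \<noteq> \<zero>}"
    using assms(2) by auto
  have "?x = (\<Oplus>l \<in> {l \<in> F. y l \<noteq> \<zero>}. ?f l)"
    by (rule A.add.finprod_mono_neutral_cong_right) (use assms(1,2) yc in auto)
  then have "decomposes ?x ?f"
    using supp assms(1) y by (auto simp: grade_zero)
  then have "component ?x = ?f"
    using A.direct_sum[OF x] decomposes_component[OF x] by blast
  then show ?thesis
    using assms(4) by simp
qed

lemma component_expand:
  assumes "x \<in> carrier A"
  obtains F where "finite F" "F \<subseteq> carrier G" "x = (\<Oplus>l \<in> F. component x l)"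
  using decomposes_component[OF assms] by (intro that[of "{k \<in> carrier G. component x k \<noteq> \<zero>}"]) auto

lemma component_homogeneous:
  assumes "k \<in> carrier G" "x \<in> grade A k"
  shows "component x k = x"
  using component_sum[of "{k}" "\<lambda>_. x" k] assms by (simp add: grade_closed)

text \<open>
  Left translation by \<open>k\<close> permutes the degrees, so multiplying the decomposition of \<open>x\<close> by \<open>u\<close> term
  by term yields the decomposition of \<open>u \<otimes> x\<close>.
\<close>
lemma component_homogeneous_mult:
  assumes k: "k \<in> carrier G" and u: "u \<in> grade A k" and x: "x \<in> carrier A" and l: "l \<in> carrier G"
  shows "component (u \<otimes> x) (k \<otimes>\<^bsub>G\<^esub> l) = u \<otimes> component x l"
proof -
  obtain F where F: "finite F" "F \<subseteq> carrier G" and xF: "x = (\<Oplus>l \<in> F. component x l)"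
    using component_expand[OF x] .
  let ?c = "component x"
  have uc: "u \<in> carrier A" 
    using grade_closed k u by blast
  have cc: "?c l \<in> carrier A" if "l \<in> carrier G" for l
    using grade_closed component_in_grade x that by blast
  have inj: "inj_on (\<lambda>l. k \<otimes>\<^bsub>G\<^esub> l) F"
    using F(2) k by (intro inj_onI) (metis G.Units_eq G.Units_l_cancel subsetD)
  \<comment> \<open>the terms of \<open>u \<otimes> x\<close>, indexed by their own degree \<open>m = k \<otimes> l\<close>\<close>
  let ?y = "\<lambda>m. u \<otimes> ?c (inv\<^bsub>G\<^esub> k \<otimes>\<^bsub>G\<^esub> m)"
  have y: "?y (k \<otimes>\<^bsub>G\<^esub> l) = u \<otimes> ?c l" if "l \<in> carrier G" for l
    using that k by (simp add: G.m_assoc[symmetric])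
  have "u \<otimes> x = u \<otimes> (\<Oplus>l \<in> F. ?c l)"
    using xF by simp
  also have "\<dots> = (\<Oplus>l \<in> F. u \<otimes> ?c l)"
    by (rule A.finsum_rdistr) (use F uc cc in auto)
  also have "\<dots> = (\<Oplus>l \<in> F. ?y (k \<otimes>\<^bsub>G\<^esub> l))"
    by (rule A.finsum_cong') (use F uc cc y in auto)
  also have "\<dots> = (\<Oplus>m \<in> (\<lambda>l. k \<otimes>\<^bsub>G\<^esub> l) ` F. ?y m)"
    by (rule A.finsum_reindex[symmetric]) (use inj F uc cc k in auto)
  finally have ux: "u \<otimes> x = (\<Oplus>m \<in> (\<lambda>l. k \<otimes>\<^bsub>G\<^esub> l) ` F. ?y m)" .
  have "component (u \<otimes> x) (k \<otimes>\<^bsub>G\<^esub> l) = (if k \<otimes>\<^bsub>G\<^esub> l \<in> (\<lambda>l. k \<otimes>\<^bsub>G\<^esub> l) ` F then ?y (k \<otimes>\<^bsub>G\<^esub> l) else \<zero>)"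
    unfolding ux
  proof (rule component_sum)
    fix m assume "m \<in> (\<lambda>l. k \<otimes>\<^bsub>G\<^esub> l) ` F"
    then obtain i where i: "i \<in> F" "m = k \<otimes>\<^bsub>G\<^esub> i" by blast
    then show "?y m \<in> grade A m"
      using y F A.grade_mult[OF k _ u component_in_grade[OF x]] by auto
  qed (use F k l in auto)
  also have "\<dots> = u \<otimes> ?c l"
  proof (cases "l \<in> F")
    case True
    then show ?thesis using y l by auto
  next
    case False
    then have "?c l = \<zero>"
      using component_sum[OF F component_in_grade[OF x] l] F xF by auto
    then show ?thesis using y l uc by auto
  qed
  finally show ?thesis .
qed

lemma base_emb_closed: "b \<in> carrier B \<Longrightarrow> base_emb A b \<in> grade A \<one>\<^bsub>G\<^esub>"
  using A.base_bij bij_betwE by blast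

lemma base_emb_ring_hom: "base_emb A \<in> ring_hom B A"
  using A.base_hom by (simp add: alg_hom_def)

lemma one_in_grade: "\<one> \<in> grade A \<one>\<^bsub>G\<^esub>"
  using base_emb_closed[OF B.one_closed] ring_hom_one[OF base_emb_ring_hom] by simp

text \<open>
  Comparing the components of degree \<open>\<one>\<close> in \<open>u \<otimes> inv u = \<one>\<close> shows that the component of \<open>inv u\<close> of
  degree \<open>inv k\<close> is by itself a right inverse of \<open>u\<close>; since \<open>u\<close> is a unit, this component is all of
  \<open>inv u\<close>.  Hence the homogeneous units form a group, and quotients of homogeneous units of the same
  degree come from units of \<open>B\<close>.
\<close>
lemma inv_in_grade:
  assumes k: "k \<in> carrier G" and u: "u \<in> grade A k" "u \<in> Units A"
  shows "inv u \<in> grade A (inv\<^bsub>G\<^esub> k)"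
proof -
  let ?v = "component (inv u) (inv\<^bsub>G\<^esub> k)"
  have v: "?v \<in> grade A (inv\<^bsub>G\<^esub> k)"
    using k u by (intro component_in_grade) auto
  have "u \<otimes> ?v = component (u \<otimes> inv u) (k \<otimes>\<^bsub>G\<^esub> inv\<^bsub>G\<^esub> k)"
    using k u by (intro component_homogeneous_mult[symmetric]) auto
  also have "\<dots> = \<one>"
    using k u one_in_grade component_homogeneous[of "\<one>\<^bsub>G\<^esub>"] by simp
  finally have "?v = inv u"
    using u v k grade_closed[OF _ v] by (metis A.Units_closed A.Units_inv_closed A.Units_l_inv A.inv_unique G.inv_closed)
  then show ?thesis using v by simp
qed

end


section \<open>Factor systems in pointwise form\<close>

lemma alg_homD:
  assumes "\<phi> \<in> alg_hom K A B"
  shows "x \<in> carrier A \<Longrightarrow> \<phi> x \<in> carrier B"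
    and "\<lbrakk>x \<in> carrier A; y \<in> carrier A\<rbrakk> \<Longrightarrow> \<phi> (x \<oplus>\<^bsub>A\<^esub> y) = \<phi> x \<oplus>\<^bsub>B\<^esub> \<phi> y"
    and "\<lbrakk>x \<in> carrier A; y \<in> carrier A\<rbrakk> \<Longrightarrow> \<phi> (x \<otimes>\<^bsub>A\<^esub> y) = \<phi> x \<otimes>\<^bsub>B\<^esub> \<phi> y"
    and "\<phi> \<one>\<^bsub>A\<^esub> = \<one>\<^bsub>B\<^esub>"
    and "\<lbrakk>a \<in> carrier K; x \<in> carrier A\<rbrakk> \<Longrightarrow> \<phi> (a \<odot>\<^bsub>A\<^esub> x) = a \<odot>\<^bsub>B\<^esub> \<phi> x"
  using assms by (auto simp: alg_hom_def ring_hom_def)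

lemma alg_homI:
  assumes "\<And>x. x \<in> carrier A \<Longrightarrow> \<phi> x \<in> carrier B"
    and "\<And>x y. \<lbrakk>x \<in> carrier A; y \<in> carrier A\<rbrakk> \<Longrightarrow> \<phi> (x \<oplus>\<^bsub>A\<^esub> y) = \<phi> x \<oplus>\<^bsub>B\<^esub> \<phi> y"
    and "\<And>x y. \<lbrakk>x \<in> carrier A; y \<in> carrier A\<rbrakk> \<Longrightarrow> \<phi> (x \<otimes>\<^bsub>A\<^esub> y) = \<phi> x \<otimes>\<^bsub>B\<^esub> \<phi> y"
    and "\<phi> \<one>\<^bsub>A\<^esub> = \<one>\<^bsub>B\<^esub>"
    and "\<And>a x. \<lbrakk>a \<in> carrier K; x \<in> carrier A\<rbrakk> \<Longrightarrow> \<phi> (a \<odot>\<^bsub>A\<^esub> x) = a \<odot>\<^bsub>B\<^esub> \<phi> x"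
  shows "\<phi> \<in> alg_hom K A B"
  using assms by (auto simp: alg_hom_def ring_hom_def)

text \<open>
  The curvature of \<open>S\<close> contains an inverse taken in this monoid, which can only be cancelled in a
  group.
\<close>
lemma (in unital_algebra) alg_AutGroup_group: "group (alg_AutGroup K A)"
proof -
  have inv: "restrict (inv_into (carrier A) f) (carrier A) \<in> alg_hom K A A"
    if f: "f \<in> alg_hom K A A" "f \<in> Bij (carrier A)" for f
  proof -
    let ?g = "inv_into (carrier A) f"
    have bij: "bij_betw f (carrier A) (carrier A)"
      using f by (simp add: Bij_def)
    have g: "?g x \<in> carrier A" "f (?g x) = x" if "x \<in> carrier A" for x
      using bij that by (auto simp: bij_betw_def intro: inv_into_into f_inv_into_f)
    have eq: "?g y = x" if "x \<in> carrier A" "f x = y" for x y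
      using bij that by (auto simp: bij_betw_def)
    note h = alg_homD[OF f(1)]
    show ?thesis
      by (rule alg_homI) (auto simp: g h intro!: eq)
  qed
  have "subgroup (alg_hom K A A \<inter> Bij (carrier A)) (BijGroup (carrier A))"
  proof
    fix f g assume f: "f \<in> alg_hom K A A \<inter> Bij (carrier A)" and g: "g \<in> alg_hom K A A \<inter> Bij (carrier A)"
    then have "compose (carrier A) f g \<in> alg_hom K A A"
      by (intro alg_homI) (auto simp: compose_eq alg_homD)
    then show "f \<otimes>\<^bsub>BijGroup (carrier A)\<^esub> g \<in> alg_hom K A A \<inter> Bij (carrier A)"
      using f g by (simp add: BijGroup_def compose_Bij)
  next
    fix f assume "f \<in> alg_hom K A A \<inter> Bij (carrier A)"
    then show "inv\<^bsub>BijGroup (carrier A)\<^esub> f \<in> alg_hom K A A \<inter> Bij (carrier A)"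
      using inv by (simp add: inv_BijGroup restrict_inv_into_Bij)
  next
    show "\<one>\<^bsub>BijGroup (carrier A)\<^esub> \<in> alg_hom K A A \<inter> Bij (carrier A)"
      by (auto simp: BijGroup_def id_Bij intro: alg_homI)
  qed (auto simp: BijGroup_def)
  then show ?thesis
    unfolding alg_AutGroup_def by (rule subgroup.subgroup_is_group) (rule group_BijGroup)
qed

lemma alg_AutGroup_carrier: "carrier (alg_AutGroup K A) = alg_hom K A A \<inter> Bij (carrier A)"
  by (simp add: alg_AutGroup_def)

lemma alg_AutGroup_one: "\<one>\<^bsub>alg_AutGroup K A\<^esub> = (\<lambda>x \<in> carrier A. x)"
  by (simp add: alg_AutGroup_def BijGroup_def)

lemma alg_AutGroup_mult:
  "\<lbrakk>f \<in> carrier (alg_AutGroup K A); g \<in> carrier (alg_AutGroup K A)\<rbrakk>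
    \<Longrightarrow> f \<otimes>\<^bsub>alg_AutGroup K A\<^esub> g = compose (carrier A) f g"
  by (simp add: alg_AutGroup_def BijGroup_def)

lemma (in unital_algebra) conj_aut_in_alg_AutGroup:
  assumes u: "u \<in> Units A"
  shows "conj_aut A u \<in> carrier (alg_AutGroup K A)"
proof -
  have uc: "u \<in> carrier A" "inv u \<in> carrier A"
    using u by auto
  have cancel: "inv u \<otimes> (u \<otimes> x) = x" "u \<otimes> (inv u \<otimes> x) = x" if "x \<in> carrier A" for x
    using u uc that by (simp_all add: m_assoc[symmetric])
  have "conj_aut A u \<in> alg_hom K A A"
    by (rule alg_homI)
      (use u uc in \<open>auto simp: conj_aut_def l_distr r_distr smult_mult_left smult_mult_right cancel m_assoc\<close>)
  moreover have "bij_betw (conj_aut A u) (carrier A) (carrier A)"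
    by (rule bij_betw_byWitness[of _ "\<lambda>x. inv u \<otimes> x \<otimes> u"])
      (use u uc in \<open>auto simp: conj_aut_def cancel m_assoc\<close>)
  ultimately show ?thesis
    by (simp add: alg_AutGroup_carrier Bij_def conj_aut_def)
qed

lemma (in monoid) conjugate_eq_iff:
  assumes "u \<in> Units G" "x \<in> carrier G" "y \<in> carrier G"
  shows "x = u \<otimes> y \<otimes> inv u \<longleftrightarrow> x \<otimes> u = u \<otimes> y"
proof
  assume "x = u \<otimes> y \<otimes> inv u"
  then have "x \<otimes> u = u \<otimes> y \<otimes> (inv u \<otimes> u)"
    using assms by (simp add: m_assoc Units_closed del: Units_l_inv)
  then show "x \<otimes> u = u \<otimes> y"
    using assms by (simp add: Units_closed)
next
  assume "x \<otimes> u = u \<otimes> y"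
  then have "u \<otimes> y \<otimes> inv u = x \<otimes> (u \<otimes> inv u)"
    using assms by (simp add: m_assoc[symmetric] Units_closed del: Units_r_inv)
  then show "x = u \<otimes> y \<otimes> inv u"
    using assms by simp
qed

context bundle_base
begin

text \<open>
  Moving the inverse of \<open>S (k \<otimes> l)\<close> to the other side and evaluating at \<open>b\<close> turns the curvature
  condition into a commutation rule without inverses, which is the rule for moving an element of \<open>B\<close>
  past a product of two homogeneous units.
\<close>
lemma curvature_eq_conj_aut_iff:
  assumes S: "\<And>k. k \<in> carrier G \<Longrightarrow> S k \<in> carrier (alg_AutGroup K B)"
    and k: "k \<in> carrier G" and l: "l \<in> carrier G" and u: "u \<in> Units B"
  shows "curvature K G B S k l = conj_aut B u \<longleftrightarrow>
    (\<forall>b \<in> carrier B. S k (S l b) \<otimes> u = u \<otimes> S (k \<otimes>\<^bsub>G\<^esub> l) b)"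
proof -
  interpret Aut: group "alg_AutGroup K B"
    by (rule B.alg_AutGroup_group)
  have kl: "S (k \<otimes>\<^bsub>G\<^esub> l) \<in> carrier (alg_AutGroup K B)"
    using S k l by simp
  have Sc: "S k b \<in> carrier B" if "k \<in> carrier G" "b \<in> carrier B" for k b
    using S[OF that(1)] that(2) by (auto simp: alg_AutGroup_carrier alg_homD)
  note c = B.conj_aut_in_alg_AutGroup[OF u]
  have "curvature K G B S k l = conj_aut B u \<longleftrightarrow>
      S k \<otimes>\<^bsub>alg_AutGroup K B\<^esub> S l = conj_aut B u \<otimes>\<^bsub>alg_AutGroup K B\<^esub> S (k \<otimes>\<^bsub>G\<^esub> l)"
    unfolding curvature_def
    using S[OF k] S[OF l] kl c by (intro Aut.inv_solve_right') auto
  also have "\<dots> \<longleftrightarrow> compose (carrier B) (S k) (S l) = compose (carrier B) (conj_aut B u) (S (k \<otimes>\<^bsub>G\<^esub> l))"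
    using S[OF k] S[OF l] kl c by (simp add: alg_AutGroup_mult)
  also have "\<dots> \<longleftrightarrow> (\<forall>b \<in> carrier B. S k (S l b) = conj_aut B u (S (k \<otimes>\<^bsub>G\<^esub> l) b))"
    unfolding fun_eq_iff compose_def by auto
  also have "\<dots> \<longleftrightarrow> (\<forall>b \<in> carrier B. S k (S l b) \<otimes> u = u \<otimes> S (k \<otimes>\<^bsub>G\<^esub> l) b)"
    using k l u by (intro ball_cong refl) (simp add: conj_aut_def Sc B.conjugate_eq_iff)
  finally show ?thesis .
qed

lemma twisted_coboundary_eq_one_iff:
  assumes "S k (\<omega> (l, m)) \<in> carrier B"
    and "\<omega> (k, l \<otimes>\<^bsub>G\<^esub> m) \<in> Units B" "\<omega> (k \<otimes>\<^bsub>G\<^esub> l, m) \<in> Units B" "\<omega> (k, l) \<in> Units B"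
  shows "twisted_coboundary G B S \<omega> k l m = \<one> \<longleftrightarrow>
    S k (\<omega> (l, m)) \<otimes> \<omega> (k, l \<otimes>\<^bsub>G\<^esub> m) = \<omega> (k, l) \<otimes> \<omega> (k \<otimes>\<^bsub>G\<^esub> l, m)"
proof -
  have "y \<otimes> inv u \<otimes> inv v = \<one> \<longleftrightarrow> y = v \<otimes> u"
    if "u \<in> Units B" "v \<in> Units B" "y \<in> carrier B" for y u v
  proof
    assume "y \<otimes> inv u \<otimes> inv v = \<one>"
    then have "y \<otimes> inv u \<otimes> (inv v \<otimes> v) \<otimes> u = v \<otimes> u"
      using that by (simp add: B.m_assoc[symmetric] B.Units_closed del: B.Units_l_inv)
    then show "y = v \<otimes> u"
      using that by (simp add: B.m_assoc B.Units_closed)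
  next
    assume "y = v \<otimes> u"
    then have "y \<otimes> inv u \<otimes> inv v = v \<otimes> (u \<otimes> inv u) \<otimes> inv v"
      using that by (simp add: B.m_assoc B.Units_closed del: B.Units_r_inv)
    then show "y \<otimes> inv u \<otimes> inv v = \<one>"
      using that by (simp add: B.Units_closed)
  qed
  then show ?thesis
    using assms by (simp add: twisted_coboundary_def B.Units_closed)
qed

text \<open>
  The conditions on a factor system in pointwise form, free of inverses.  In this form they are
  what the section of a bundle satisfies and what makes the product of the crossed product
  associative.
\<close>
lemma factor_systems_iff:
  "(S, \<omega>) \<in> factor_systems K G B \<longleftrightarrow>
     S \<in> extensional (carrier G) \<and> (\<forall>k \<in> carrier G. S k \<in> alg_hom K B B \<inter> Bij (carrier B)) \<and>
     S \<one>\<^bsub>G\<^esub> = (\<lambda>b \<in> carrier B. b) \<and>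
     \<omega> \<in> extensional (carrier G \<times> carrier G) \<and>
     (\<forall>k \<in> carrier G. \<forall>l \<in> carrier G. \<omega> (k, l) \<in> Units B) \<and>
     (\<forall>k \<in> carrier G. \<omega> (k, \<one>\<^bsub>G\<^esub>) = \<one> \<and> \<omega> (\<one>\<^bsub>G\<^esub>, k) = \<one>) \<and>
     (\<forall>k \<in> carrier G. \<forall>l \<in> carrier G. \<forall>b \<in> carrier B.
        S k (S l b) \<otimes> \<omega> (k, l) = \<omega> (k, l) \<otimes> S (k \<otimes>\<^bsub>G\<^esub> l) b) \<and>
     (\<forall>k \<in> carrier G. \<forall>l \<in> carrier G. \<forall>m \<in> carrier G.
        S k (\<omega> (l, m)) \<otimes> \<omega> (k, l \<otimes>\<^bsub>G\<^esub> m) = \<omega> (k, l) \<otimes> \<omega> (k \<otimes>\<^bsub>G\<^esub> l, m))"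
proof -
  \<comment> \<open>the conditions on the single cochains, under which the other two conditions can be rewritten\<close>
  define P where "P \<longleftrightarrow> S \<in> cochains1 G (alg_AutGroup K B) \<and> \<omega> \<in> cochains2 G (units_of B)"
  have P: "P \<longleftrightarrow> S \<in> extensional (carrier G) \<and> (\<forall>k \<in> carrier G. S k \<in> alg_hom K B B \<inter> Bij (carrier B)) \<and>
     S \<one>\<^bsub>G\<^esub> = (\<lambda>b \<in> carrier B. b) \<and>
     \<omega> \<in> extensional (carrier G \<times> carrier G) \<and>
     (\<forall>k \<in> carrier G. \<forall>l \<in> carrier G. \<omega> (k, l) \<in> Units B) \<and>
     (\<forall>k \<in> carrier G. \<omega> (k, \<one>\<^bsub>G\<^esub>) = \<one> \<and> \<omega> (\<one>\<^bsub>G\<^esub>, k) = \<one>)"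
    unfolding P_def cochains1_def cochains2_def
    by (auto simp: alg_AutGroup_carrier alg_AutGroup_one units_of_def PiE_iff)
  have "(S, \<omega>) \<in> factor_systems K G B \<longleftrightarrow> P \<and>
     (\<forall>k \<in> carrier G. \<forall>l \<in> carrier G. curvature K G B S k l = conj_aut B (\<omega> (k, l))) \<and>
     (\<forall>k \<in> carrier G. \<forall>l \<in> carrier G. \<forall>m \<in> carrier G. twisted_coboundary G B S \<omega> k l m = \<one>)"
    by (auto simp: factor_systems_def P_def)
  also have "\<dots> \<longleftrightarrow> P \<and>
     (\<forall>k \<in> carrier G. \<forall>l \<in> carrier G. \<forall>b \<in> carrier B.
        S k (S l b) \<otimes> \<omega> (k, l) = \<omega> (k, l) \<otimes> S (k \<otimes>\<^bsub>G\<^esub> l) b) \<and>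
     (\<forall>k \<in> carrier G. \<forall>l \<in> carrier G. \<forall>m \<in> carrier G.
        S k (\<omega> (l, m)) \<otimes> \<omega> (k, l \<otimes>\<^bsub>G\<^esub> m) = \<omega> (k, l) \<otimes> \<omega> (k \<otimes>\<^bsub>G\<^esub> l, m))"
  proof (rule conj_cong[OF refl], intro conj_cong ball_cong refl)
    fix k l assume "P" "k \<in> carrier G" "l \<in> carrier G"
    then show "curvature K G B S k l = conj_aut B (\<omega> (k, l)) \<longleftrightarrow>
      (\<forall>b \<in> carrier B. S k (S l b) \<otimes> \<omega> (k, l) = \<omega> (k, l) \<otimes> S (k \<otimes>\<^bsub>G\<^esub> l) b)"
      unfolding P by (intro curvature_eq_conj_aut_iff) (auto simp: alg_AutGroup_carrier)
  next
    fix k l m assume "P" "k \<in> carrier G" "l \<in> carrier G" "m \<in> carrier G"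
    then show "twisted_coboundary G B S \<omega> k l m = \<one> \<longleftrightarrow>
        S k (\<omega> (l, m)) \<otimes> \<omega> (k, l \<otimes>\<^bsub>G\<^esub> m) = \<omega> (k, l) \<otimes> \<omega> (k \<otimes>\<^bsub>G\<^esub> l, m)"
      unfolding P using alg_homD(1)[of "S k" K B B "\<omega> (l, m)"]
      by (intro twisted_coboundary_eq_one_iff) (auto intro: B.Units_closed)
  qed
  finally show ?thesis
    unfolding P by blast
qed

end


section \<open>Factor systems of sections\<close>

context graded_bundle
begin

lemma base_emb_in_carrier: "b \<in> carrier B \<Longrightarrow> base_emb A b \<in> carrier A"
  using base_emb_closed grade_closed by blast

lemmas base_emb_hom = alg_homD(2-5)[OF A.base_hom]

lemma base_emb_eq_iff:
  "\<lbrakk>b \<in> carrier B; c \<in> carrier B\<rbrakk> \<Longrightarrow> base_emb A b = base_emb A c \<longleftrightarrow> b = c"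
  using A.base_bij by (auto simp: bij_betw_def inj_on_def)

lemma base_emb_inv_into:
  assumes "x \<in> grade A \<one>\<^bsub>G\<^esub>"
  shows "inv_into (carrier B) (base_emb A) x \<in> carrier B"
    and "base_emb A (inv_into (carrier B) (base_emb A) x) = x"
  using A.base_bij assms by (auto simp: bij_betw_def intro: inv_into_into f_inv_into_f)

lemma base_emb_Units: "u \<in> Units B \<Longrightarrow> base_emb A u \<in> Units A"
  using base_emb_hom(2)[of u "inv\<^bsub>B\<^esub> u"] base_emb_hom(2)[of "inv\<^bsub>B\<^esub> u" u] base_emb_hom(3)
    base_emb_in_carrier[of u] base_emb_in_carrier[of "inv\<^bsub>B\<^esub> u"]
  unfolding Units_def[of A] by (auto simp: B.Units_closed intro!: bexI[of _ "base_emb A (inv\<^bsub>B\<^esub> u)"])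

lemma inv_into_Units:
  assumes x: "x \<in> grade A \<one>\<^bsub>G\<^esub>" "x \<in> Units A"
  shows "inv_into (carrier B) (base_emb A) x \<in> Units B"
proof -
  let ?r = "inv_into (carrier B) (base_emb A)"
  have y: "inv x \<in> grade A \<one>\<^bsub>G\<^esub>"
    using inv_in_grade[OF G.one_closed x] by simp
  have "?r x \<otimes>\<^bsub>B\<^esub> ?r (inv x) = \<one>\<^bsub>B\<^esub>" "?r (inv x) \<otimes>\<^bsub>B\<^esub> ?r x = \<one>\<^bsub>B\<^esub>"
    using base_emb_inv_into[OF x(1)] base_emb_inv_into[OF y] x(2)
    by (simp_all add: base_emb_hom flip: base_emb_eq_iff)
  then show ?thesis
    using base_emb_inv_into[OF x(1)] base_emb_inv_into[OF y] unfolding Units_def by blast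
qed

lemma homogeneous_sectionD:
  assumes "\<sigma> \<in> homogeneous_sections G A"
  shows "k \<in> carrier G \<Longrightarrow> \<sigma> k \<in> grade A k" and "k \<in> carrier G \<Longrightarrow> \<sigma> k \<in> Units A"
    and "k \<in> carrier G \<Longrightarrow> \<sigma> k \<in> carrier A" and "\<sigma> \<one>\<^bsub>G\<^esub> = \<one>" and "\<sigma> \<in> extensional (carrier G)"
  using assms by (auto simp: homogeneous_sections_def PiE_iff)

lemma homogeneous_sections_nonempty: "homogeneous_sections G A \<noteq> {}"
proof -
  have "\<forall>k \<in> carrier G. \<exists>x. x \<in> grade A k \<inter> Units A"
    using A.invertible by blast
  then obtain \<tau> where \<tau>: "\<And>k. k \<in> carrier G \<Longrightarrow> \<tau> k \<in> grade A k \<inter> Units A"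
    by metis
  have "(\<lambda>k \<in> carrier G. if k = \<one>\<^bsub>G\<^esub> then \<one> else \<tau> k) \<in> homogeneous_sections G A"
    using \<tau> one_in_grade by (auto simp: homogeneous_sections_def)
  then show ?thesis by blast
qed

lemma base_emb_mult_in_grade:
  "\<lbrakk>b \<in> carrier B; k \<in> carrier G; x \<in> grade A k\<rbrakk> \<Longrightarrow> base_emb A b \<otimes> x \<in> grade A k"
  using A.grade_mult[of "\<one>\<^bsub>G\<^esub>" k "base_emb A b" x] base_emb_closed by simp

lemma Units_mult_right_cancel:
  "\<lbrakk>u \<in> Units A; x \<in> carrier A; y \<in> carrier A\<rbrakk> \<Longrightarrow> x \<otimes> u = y \<otimes> u \<longleftrightarrow> x = y"
  by (metis A.Units_closed A.Units_inv_closed A.Units_r_inv A.m_assoc A.r_one)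

lemma base_emb_mult_Units_cancel:
  "\<lbrakk>u \<in> Units A; b \<in> carrier B; c \<in> carrier B\<rbrakk>
    \<Longrightarrow> base_emb A b \<otimes> u = base_emb A c \<otimes> u \<longleftrightarrow> b = c"
  by (simp add: Units_mult_right_cancel base_emb_in_carrier base_emb_eq_iff)

text \<open>
  The quotient \<open>x \<otimes> inv u\<close> has degree \<open>\<one>\<close> and so lies in the image of \<open>B\<close>.  In this way a unit of degree
  \<open>k\<close> makes the grading space of degree \<open>k\<close> a free module of rank one over \<open>B\<close>.
\<close>
lemma homogeneous_coefficient:
  assumes k: "k \<in> carrier G" and u: "u \<in> grade A k" "u \<in> Units A" and x: "x \<in> grade A k"
  shows "inv_into (carrier B) (base_emb A) (x \<otimes> inv u) \<in> carrier B"
    and "base_emb A (inv_into (carrier B) (base_emb A) (x \<otimes> inv u)) \<otimes> u = x"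
    and "x \<in> Units A \<Longrightarrow> inv_into (carrier B) (base_emb A) (x \<otimes> inv u) \<in> Units B"
proof -
  have g: "x \<otimes> inv u \<in> grade A \<one>\<^bsub>G\<^esub>"
    using A.grade_mult[OF k _ x inv_in_grade[OF k u]] k by simp
  then show "inv_into (carrier B) (base_emb A) (x \<otimes> inv u) \<in> carrier B"
    by (rule base_emb_inv_into)
  show "base_emb A (inv_into (carrier B) (base_emb A) (x \<otimes> inv u)) \<otimes> u = x"
    using g u x grade_closed[OF k] by (simp add: base_emb_inv_into A.m_assoc)
  show "x \<in> Units A \<Longrightarrow> inv_into (carrier B) (base_emb A) (x \<otimes> inv u) \<in> Units B"
    using g u by (intro inv_into_Units) auto
qed

text \<open>
  The factor system of \<open>\<sigma>\<close> is governed by two relations: \<open>S k b\<close> is what \<open>b\<close> becomes when it is moved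
  to the left past \<open>\<sigma> k\<close>, and \<open>\<omega> (k, l)\<close> is the coefficient of \<open>\<sigma> k \<otimes> \<sigma> l\<close> with respect to
  \<open>\<sigma> (k \<otimes> l)\<close>.  Together with the lemma that follows, this allows calculations without
  \<open>inv_into\<close> and without inverses of section values.
\<close>
lemma section_factor_systemD:
  assumes \<sigma>: "\<sigma> \<in> homogeneous_sections G A" and eq: "section_factor_system G B A \<sigma> = (S, \<omega>)"
    and k: "k \<in> carrier G"
  shows "b \<in> carrier B \<Longrightarrow> S k b \<in> carrier B"
    and "b \<in> carrier B \<Longrightarrow> base_emb A (S k b) \<otimes> \<sigma> k = \<sigma> k \<otimes> base_emb A b"
    and "l \<in> carrier G \<Longrightarrow> \<omega> (k, l) \<in> Units B"
    and "l \<in> carrier G \<Longrightarrow> base_emb A (\<omega> (k, l)) \<otimes> \<sigma> (k \<otimes>\<^bsub>G\<^esub> l) = \<sigma> k \<otimes> \<sigma> l"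
    and "S \<in> extensional (carrier G)" and "S k \<in> extensional (carrier B)"
    and "\<omega> \<in> extensional (carrier G \<times> carrier G)"
proof -
  note s = homogeneous_sectionD[OF \<sigma>]
  have *: "\<sigma> k \<otimes> base_emb A b \<in> grade A k" if "b \<in> carrier B" for b
    using A.grade_mult[OF k G.one_closed s(1)[OF k] base_emb_closed[OF that]] k by simp
  show "b \<in> carrier B \<Longrightarrow> S k b \<in> carrier B"
    and "b \<in> carrier B \<Longrightarrow> base_emb A (S k b) \<otimes> \<sigma> k = \<sigma> k \<otimes> base_emb A b"
    using homogeneous_coefficient[OF k s(1,2)[OF k] *] k eq by (auto simp: section_factor_system_def)
  show "\<omega> (k, l) \<in> Units B" "base_emb A (\<omega> (k, l)) \<otimes> \<sigma> (k \<otimes>\<^bsub>G\<^esub> l) = \<sigma> k \<otimes> \<sigma> l"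
    if l: "l \<in> carrier G"
    using homogeneous_coefficient[of "k \<otimes>\<^bsub>G\<^esub> l" "\<sigma> (k \<otimes>\<^bsub>G\<^esub> l)" "\<sigma> k \<otimes> \<sigma> l"] s k l
      A.grade_mult[OF k l s(1)[OF k] s(1)[OF l]] eq
    by (auto simp: section_factor_system_def)
  show "S \<in> extensional (carrier G)" "S k \<in> extensional (carrier B)"
    "\<omega> \<in> extensional (carrier G \<times> carrier G)"
    using eq k by (auto simp: section_factor_system_def)
qed

text \<open>
  The two relations determine the factor system, because the values of \<open>\<sigma>\<close> can be cancelled and
  \<open>base_emb A\<close> is injective.
\<close>
lemma section_factor_system_eqI:
  assumes \<sigma>: "\<sigma> \<in> homogeneous_sections G A"
    and ext: "S \<in> extensional (carrier G)" "\<And>k. k \<in> carrier G \<Longrightarrow> S k \<in> extensional (carrier B)"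
      "\<omega> \<in> extensional (carrier G \<times> carrier G)"
    and closed: "\<And>k b. \<lbrakk>k \<in> carrier G; b \<in> carrier B\<rbrakk> \<Longrightarrow> S k b \<in> carrier B"
      "\<And>k l. \<lbrakk>k \<in> carrier G; l \<in> carrier G\<rbrakk> \<Longrightarrow> \<omega> (k, l) \<in> carrier B"
    and comm: "\<And>k b. \<lbrakk>k \<in> carrier G; b \<in> carrier B\<rbrakk>
        \<Longrightarrow> base_emb A (S k b) \<otimes> \<sigma> k = \<sigma> k \<otimes> base_emb A b"
    and mult: "\<And>k l. \<lbrakk>k \<in> carrier G; l \<in> carrier G\<rbrakk>
        \<Longrightarrow> base_emb A (\<omega> (k, l)) \<otimes> \<sigma> (k \<otimes>\<^bsub>G\<^esub> l) = \<sigma> k \<otimes> \<sigma> l"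
  shows "section_factor_system G B A \<sigma> = (S, \<omega>)"
proof -
  obtain S' \<omega>' where eq: "section_factor_system G B A \<sigma> = (S', \<omega>')"
    by fastforce
  note D = section_factor_systemD[OF \<sigma> eq] and s = homogeneous_sectionD[OF \<sigma>]
  have "S' k b = S k b" if "k \<in> carrier G" "b \<in> carrier B" for k b
    using that base_emb_mult_Units_cancel[OF s(2), of k "S' k b" "S k b"] by (simp add: D closed comm)
  then have "S' k = S k" if "k \<in> carrier G" for k
    using that by (intro extensionalityI[OF D(6) ext(2)]) auto
  then have "S' = S"
    using G.one_closed by (intro extensionalityI[OF D(5) ext(1)]) auto
  moreover have "\<omega>' (k, l) = \<omega> (k, l)" if "k \<in> carrier G" "l \<in> carrier G" for k l
    using that base_emb_mult_Units_cancel[OF s(2), of "k \<otimes>\<^bsub>G\<^esub> l" "\<omega>' (k, l)" "\<omega> (k, l)"]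
    by (simp add: D B.Units_closed closed mult)
  then have "\<omega>' = \<omega>"
    using G.one_closed by (intro extensionalityI[OF D(7) ext(3)]) auto
  ultimately show ?thesis
    using eq by simp
qed

text \<open>
  Each required identity between elements of \<open>B\<close> may be checked after applying \<open>base_emb A\<close> and
  multiplying by a value of \<open>\<sigma>\<close> from the right.  The commutation rule and the cocycle identity then
  come out as two ways of evaluating \<open>\<sigma> k \<otimes> \<sigma> l \<otimes> b\<close> and \<open>\<sigma> k \<otimes> \<sigma> l \<otimes> \<sigma> m\<close>, that is, as
  associativity of \<open>A\<close>.
\<close>
lemma section_factor_system_in_factor_systems:
  assumes \<sigma>: "\<sigma> \<in> homogeneous_sections G A"
  shows "section_factor_system G B A \<sigma> \<in> factor_systems K G B"
proof -
  obtain S \<omega> where eq: "section_factor_system G B A \<sigma> = (S, \<omega>)"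
    by fastforce
  note D = section_factor_systemD[OF \<sigma> eq] and s = homogeneous_sectionD[OF \<sigma>]
  let ?j = "base_emb A"
  note [simp] = s(2,3,4) D(1,3) B.Units_closed[OF D(3)] base_emb_in_carrier
  have eqI: "b = c" if "k \<in> carrier G" "b \<in> carrier B" "c \<in> carrier B" "?j b \<otimes> \<sigma> k = ?j c \<otimes> \<sigma> k" for k b c
    using that base_emb_mult_Units_cancel[OF s(2)] by blast
  \<comment> \<open>the two relations with a further factor \<open>x\<close>, for products bracketed to the right\<close>
  have comm: "\<sigma> k \<otimes> (?j b \<otimes> x) = ?j (S k b) \<otimes> (\<sigma> k \<otimes> x)"
    if "k \<in> carrier G" "b \<in> carrier B" "x \<in> carrier A" for k b x
    using that D(2)[of k b] by (simp add: A.m_assoc[symmetric])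
  have mult: "\<sigma> k \<otimes> (\<sigma> l \<otimes> x) = ?j (\<omega> (k, l)) \<otimes> (\<sigma> (k \<otimes>\<^bsub>G\<^esub> l) \<otimes> x)"
    if "k \<in> carrier G" "l \<in> carrier G" "x \<in> carrier A" for k l x
    using that D(4)[of k l] by (simp add: A.m_assoc[symmetric])
  note rules = A.m_assoc D(2) D(4) comm mult base_emb_hom
  have hom: "S k \<in> alg_hom K B B" if k: "k \<in> carrier G" for k
  proof (rule alg_homI)
    fix x y assume "x \<in> carrier B" "y \<in> carrier B"
    then show "S k (x \<oplus>\<^bsub>B\<^esub> y) = S k x \<oplus>\<^bsub>B\<^esub> S k y"
      using k by (intro eqI[OF k]) (simp_all add: rules A.l_distr A.r_distr)
    show "S k (x \<otimes>\<^bsub>B\<^esub> y) = S k x \<otimes>\<^bsub>B\<^esub> S k y"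
      using k \<open>x \<in> carrier B\<close> \<open>y \<in> carrier B\<close> by (intro eqI[OF k]) (simp_all add: rules)
  next
    show "S k \<one>\<^bsub>B\<^esub> = \<one>\<^bsub>B\<^esub>"
      using k by (intro eqI[OF k]) (simp_all add: rules)
  next
    fix a x assume "a \<in> carrier K" "x \<in> carrier B"
    then show "S k (a \<odot>\<^bsub>B\<^esub> x) = a \<odot>\<^bsub>B\<^esub> S k x"
      using k by (intro eqI[OF k]) (simp_all add: rules A.smult_mult_left A.smult_mult_right)
  qed (use k in simp)
  have bij: "bij_betw (S k) (carrier B) (carrier B)" if k: "k \<in> carrier G" for k
  proof (rule bij_betwI')
    fix x y assume "x \<in> carrier B" "y \<in> carrier B"
    then show "S k x = S k y \<longleftrightarrow> x = y"
      using D(2)[OF k, of x] D(2)[OF k, of y] k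
      by (metis A.Units_l_cancel base_emb_eq_iff base_emb_in_carrier s(2))
  next
    fix c assume c: "c \<in> carrier B"
    have "inv \<sigma> k \<otimes> (?j c \<otimes> \<sigma> k) \<in> grade A (inv\<^bsub>G\<^esub> k \<otimes>\<^bsub>G\<^esub> k)"
      using k c s by (intro A.grade_mult inv_in_grade base_emb_mult_in_grade) auto
    then obtain b where b: "b \<in> carrier B" "?j b = inv \<sigma> k \<otimes> (?j c \<otimes> \<sigma> k)"
      using k base_emb_inv_into by (metis G.l_inv)
    have "c = S k b"
      using k b c by (intro eqI[OF k]) (simp_all add: D(2) A.m_assoc[symmetric])
    then show "\<exists>b \<in> carrier B. c = S k b"
      using b by blast
  qed (use k in simp)
  have one: "S \<one>\<^bsub>G\<^esub> = (\<lambda>b \<in> carrier B. b)"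
  proof (rule extensionalityI[OF D(6)])
    show "S \<one>\<^bsub>G\<^esub> b = (\<lambda>b \<in> carrier B. b) b" if "b \<in> carrier B" for b
      using D(2)[of "\<one>\<^bsub>G\<^esub>" b] that by (intro eqI[of "\<one>\<^bsub>G\<^esub>"]) simp_all
  qed simp_all
  show ?thesis
    unfolding eq factor_systems_iff
  proof (intro conjI ballI)
    show "S \<in> extensional (carrier G)" "\<omega> \<in> extensional (carrier G \<times> carrier G)"
      using D(5,7)[of "\<one>\<^bsub>G\<^esub>"] by simp_all
    fix k assume k: "k \<in> carrier G"
    show "S k \<in> alg_hom K B B \<inter> Bij (carrier B)"
      using hom[OF k] bij[OF k] D(6)[OF k] by (simp add: Bij_def)
    show "\<omega> (k, \<one>\<^bsub>G\<^esub>) = \<one>\<^bsub>B\<^esub>" "\<omega> (\<one>\<^bsub>G\<^esub>, k) = \<one>\<^bsub>B\<^esub>"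
      using k D(4)[of k "\<one>\<^bsub>G\<^esub>"] D(4)[of "\<one>\<^bsub>G\<^esub>" k] by (auto intro!: eqI[of k] simp: base_emb_hom)
    fix l assume l: "l \<in> carrier G"
    show "\<omega> (k, l) \<in> Units B"
      using k l by simp
    show "S k (S l b) \<otimes>\<^bsub>B\<^esub> \<omega> (k, l) = \<omega> (k, l) \<otimes>\<^bsub>B\<^esub> S (k \<otimes>\<^bsub>G\<^esub> l) b" if b: "b \<in> carrier B" for b
    proof (rule eqI)
      have "?j (S k (S l b) \<otimes>\<^bsub>B\<^esub> \<omega> (k, l)) \<otimes> \<sigma> (k \<otimes>\<^bsub>G\<^esub> l) = \<sigma> k \<otimes> (\<sigma> l \<otimes> ?j b)"
        using k l b by (simp add: A.m_assoc base_emb_hom D(4) comm flip: D(2))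
      also have "\<dots> = ?j (\<omega> (k, l) \<otimes>\<^bsub>B\<^esub> S (k \<otimes>\<^bsub>G\<^esub> l) b) \<otimes> \<sigma> (k \<otimes>\<^bsub>G\<^esub> l)"
        using k l b by (simp add: A.m_assoc base_emb_hom mult D(2))
      finally show "?j (S k (S l b) \<otimes>\<^bsub>B\<^esub> \<omega> (k, l)) \<otimes> \<sigma> (k \<otimes>\<^bsub>G\<^esub> l)
        = ?j (\<omega> (k, l) \<otimes>\<^bsub>B\<^esub> S (k \<otimes>\<^bsub>G\<^esub> l) b) \<otimes> \<sigma> (k \<otimes>\<^bsub>G\<^esub> l)" .
    qed (use k l b in simp_all)
    show "S k (\<omega> (l, m)) \<otimes>\<^bsub>B\<^esub> \<omega> (k, l \<otimes>\<^bsub>G\<^esub> m) = \<omega> (k, l) \<otimes>\<^bsub>B\<^esub> \<omega> (k \<otimes>\<^bsub>G\<^esub> l, m)"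
      if m: "m \<in> carrier G" for m
    proof (rule eqI)
      have "?j (S k (\<omega> (l, m)) \<otimes>\<^bsub>B\<^esub> \<omega> (k, l \<otimes>\<^bsub>G\<^esub> m)) \<otimes> \<sigma> (k \<otimes>\<^bsub>G\<^esub> l \<otimes>\<^bsub>G\<^esub> m) = \<sigma> k \<otimes> (\<sigma> l \<otimes> \<sigma> m)"
        using k l m D(4)[of k "l \<otimes>\<^bsub>G\<^esub> m"] D(4)[of l m]
        by (simp add: A.m_assoc base_emb_hom G.m_assoc comm[symmetric])
      also have "\<dots> = ?j (\<omega> (k, l) \<otimes>\<^bsub>B\<^esub> \<omega> (k \<otimes>\<^bsub>G\<^esub> l, m)) \<otimes> \<sigma> (k \<otimes>\<^bsub>G\<^esub> l \<otimes>\<^bsub>G\<^esub> m)"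
        using k l m D(4)[of "k \<otimes>\<^bsub>G\<^esub> l" m] by (simp add: A.m_assoc base_emb_hom mult)
      finally show "?j (S k (\<omega> (l, m)) \<otimes>\<^bsub>B\<^esub> \<omega> (k, l \<otimes>\<^bsub>G\<^esub> m)) \<otimes> \<sigma> (k \<otimes>\<^bsub>G\<^esub> l \<otimes>\<^bsub>G\<^esub> m)
        = ?j (\<omega> (k, l) \<otimes>\<^bsub>B\<^esub> \<omega> (k \<otimes>\<^bsub>G\<^esub> l, m)) \<otimes> \<sigma> (k \<otimes>\<^bsub>G\<^esub> l \<otimes>\<^bsub>G\<^esub> m)" .
    qed (use k l m in simp_all)
  qed (fact one)
qed

text \<open>
  The shape of the action comes from moving all coefficients to the left of all section values:
  passing \<open>h l\<close> over \<open>\<sigma> k\<close> produces the factor \<open>S k (h l)\<close>, and passing \<open>b\<close> over \<open>h k\<close> times \<open>\<sigma> k\<close>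
  conjugates \<open>S k b\<close> by \<open>h k\<close>.
\<close>
lemma section_factor_system_twist:
  assumes \<sigma>: "\<sigma> \<in> homogeneous_sections G A" and h: "h \<in> cochains1 G (units_of B)"
  defines "\<tau> \<equiv> \<lambda>k \<in> carrier G. base_emb A (h k) \<otimes> \<sigma> k"
  shows "\<tau> \<in> homogeneous_sections G A"
    and "section_factor_system G B A \<tau> = cochain_act K G B h (section_factor_system G B A \<sigma>)"
proof -
  obtain S \<omega> where eq: "section_factor_system G B A \<sigma> = (S, \<omega>)"
    by fastforce
  note D = section_factor_systemD[OF \<sigma> eq] and s = homogeneous_sectionD[OF \<sigma>]
  have fs: "(S, \<omega>) \<in> factor_systems K G B"
    using section_factor_system_in_factor_systems[OF \<sigma>] eq by simp
  have hU: "h k \<in> Units B" if "k \<in> carrier G" for k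
    using h that by (auto simp: cochains1_def units_of_def)
  have h1: "h \<one>\<^bsub>G\<^esub> = \<one>\<^bsub>B\<^esub>"
    using h by (simp add: cochains1_def units_of_def)
  let ?j = "base_emb A"
  note [simp] = s(2,3,4) D(1,3) B.Units_closed[OF D(3)] base_emb_in_carrier hU B.Units_closed[OF hU]
    base_emb_Units
  show \<tau>: "\<tau> \<in> homogeneous_sections G A"
    using h1 by (auto simp: \<tau>_def homogeneous_sections_def base_emb_hom s intro!: base_emb_mult_in_grade)
  have act: "cochain_act K G B h (S, \<omega>) =
     (\<lambda>k \<in> carrier G. compose (carrier B) (conj_aut B (h k)) (S k),
      \<lambda>(k, l) \<in> carrier G \<times> carrier G.
        h k \<otimes>\<^bsub>B\<^esub> S k (h l) \<otimes>\<^bsub>B\<^esub> \<omega> (k, l) \<otimes>\<^bsub>B\<^esub> inv\<^bsub>B\<^esub> h (k \<otimes>\<^bsub>G\<^esub> l))"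
    using fs B.conj_aut_in_alg_AutGroup[OF hU]
    by (auto simp: factor_systems_iff alg_AutGroup_carrier intro!: restrict_ext alg_AutGroup_mult)
  have cancel: "?j (inv\<^bsub>B\<^esub> u) \<otimes> (?j u \<otimes> x) = x" if "u \<in> Units B" "x \<in> carrier A" for u x
    using that B.Units_closed[OF that(1)] by (simp add: A.m_assoc[symmetric] flip: base_emb_hom(2)) (simp add: base_emb_hom)
  show "section_factor_system G B A \<tau> = cochain_act K G B h (section_factor_system G B A \<sigma>)"
    unfolding eq act
  proof (rule section_factor_system_eqI[OF \<tau>])
    fix k b assume k: "k \<in> carrier G" and b: "b \<in> carrier B"
    have "?j (S k b) \<otimes> \<sigma> k = \<sigma> k \<otimes> ?j b"
      using D(2)[OF k b] .
    then show "?j ((\<lambda>k \<in> carrier G. compose (carrier B) (conj_aut B (h k)) (S k)) k b) \<otimes> \<tau> k = \<tau> k \<otimes> ?j b"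
      using k b by (simp add: compose_eq conj_aut_def base_emb_hom \<tau>_def A.m_assoc cancel)
    show "(\<lambda>k \<in> carrier G. compose (carrier B) (conj_aut B (h k)) (S k)) k b \<in> carrier B"
      using k b by (simp add: compose_eq conj_aut_def)
  next
    fix k l assume k: "k \<in> carrier G" and l: "l \<in> carrier G"
    have "?j (S k (h l)) \<otimes> (\<sigma> k \<otimes> \<sigma> l) = \<sigma> k \<otimes> (?j (h l) \<otimes> \<sigma> l)"
      using D(2)[of k "h l"] k l by (simp add: A.m_assoc[symmetric])
    then show "?j ((\<lambda>(k, l) \<in> carrier G \<times> carrier G.
        h k \<otimes>\<^bsub>B\<^esub> S k (h l) \<otimes>\<^bsub>B\<^esub> \<omega> (k, l) \<otimes>\<^bsub>B\<^esub> inv\<^bsub>B\<^esub> h (k \<otimes>\<^bsub>G\<^esub> l)) (k, l)) \<otimes> \<tau> (k \<otimes>\<^bsub>G\<^esub> l) = \<tau> k \<otimes> \<tau> l"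
      using k l D(4)[of k l] by (simp add: base_emb_hom \<tau>_def A.m_assoc cancel)
    show "(\<lambda>(k, l) \<in> carrier G \<times> carrier G.
        h k \<otimes>\<^bsub>B\<^esub> S k (h l) \<otimes>\<^bsub>B\<^esub> \<omega> (k, l) \<otimes>\<^bsub>B\<^esub> inv\<^bsub>B\<^esub> h (k \<otimes>\<^bsub>G\<^esub> l)) (k, l) \<in> carrier B"
      using k l by simp
  qed simp_all
qed

text \<open>
  Two sections differ by a cochain with values in the units of \<open>B\<close>, so the orbit of one factor system
  of \<open>A\<close> consists of the factor systems of all sections of \<open>A\<close>.  The right-hand side involves no
  choice, and independence of the section and invariance under isomorphism are read off from it.
\<close>
lemma cohomology_class_section_factor_system:
  assumes \<sigma>: "\<sigma> \<in> homogeneous_sections G A"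
  shows "cohomology_class K G B (section_factor_system G B A \<sigma>)
    = section_factor_system G B A ` homogeneous_sections G A"
proof
  show "cohomology_class K G B (section_factor_system G B A \<sigma>)
    \<subseteq> section_factor_system G B A ` homogeneous_sections G A"
    using section_factor_system_twist[OF \<sigma>] by (force simp: cohomology_class_def)
next
  show "section_factor_system G B A ` homogeneous_sections G A
    \<subseteq> cohomology_class K G B (section_factor_system G B A \<sigma>)"
  proof
    fix t assume "t \<in> section_factor_system G B A ` homogeneous_sections G A"
    then obtain \<tau> where \<tau>: "\<tau> \<in> homogeneous_sections G A" and t: "t = section_factor_system G B A \<tau>"
      by blast
    note s = homogeneous_sectionD[OF \<sigma>] and s' = homogeneous_sectionD[OF \<tau>]
    let ?j = "base_emb A"
    \<comment> \<open>the cochain by which the two sections differ\<close>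
    define h where "h = (\<lambda>k \<in> carrier G. inv_into (carrier B) ?j (\<tau> k \<otimes> inv \<sigma> k))"
    have hU: "h k \<in> Units B" and hj: "?j (h k) \<otimes> \<sigma> k = \<tau> k" if "k \<in> carrier G" for k
      using homogeneous_coefficient[OF that s(1,2) s'(1)] s'(2) that by (auto simp: h_def)
    have "h \<one>\<^bsub>G\<^esub> = \<one>\<^bsub>B\<^esub>"
      using hj[of "\<one>\<^bsub>G\<^esub>"] hU[of "\<one>\<^bsub>G\<^esub>"] s(4) s'(4)
      by (simp add: base_emb_in_carrier B.Units_closed base_emb_hom flip: base_emb_eq_iff)
    then have h: "h \<in> cochains1 G (units_of B)"
      using hU by (auto simp: cochains1_def units_of_def h_def)
    have "(\<lambda>k \<in> carrier G. ?j (h k) \<otimes> \<sigma> k) = \<tau>"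
      using hj s'(5) by (intro extensionalityI[of _ "carrier G"]) auto
    then have "t = cochain_act K G B h (section_factor_system G B A \<sigma>)"
      using section_factor_system_twist(2)[OF \<sigma> h] t by simp
    then show "t \<in> cohomology_class K G B (section_factor_system G B A \<sigma>)"
      using h by (auto simp: cohomology_class_def)
  qed
qed

lemma char_class_eq: "char_class K G B A = section_factor_system G B A ` homogeneous_sections G A"
  using cohomology_class_section_factor_system[OF some_in_eq[THEN iffD2, OF homogeneous_sections_nonempty]]
  by (simp add: char_class_def)

end


section \<open>The crossed product algebra\<close>

locale crossed_product_data = bundle_base K G B
  for K :: "('k, 'm) ring_scheme" and G :: "('g, 'q) monoid_scheme"
    and B :: "('k, 'b, 'y) module_scheme" (structure) +
  fixes S :: "'g \<Rightarrow> 'b \<Rightarrow> 'b" and \<omega> :: "'g \<times> 'g \<Rightarrow> 'b"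
  assumes factor_system: "(S, \<omega>) \<in> factor_systems K G B"
begin

text \<open>
  The family \<open>single b k\<close> stands for the monomial \<open>b u\<^sub>k\<close> in the formal symbols \<open>u\<^sub>k\<close>, and a family \<open>f\<close> for
  the formal sum of the monomials \<open>f k u\<^sub>k\<close>.
\<close>
definition single :: "'b \<Rightarrow> 'g \<Rightarrow> 'g \<Rightarrow> 'b" where
  "single b k = (\<lambda>l \<in> carrier G. if l = k then b else \<zero>)"

text \<open>
  The coefficient of \<open>u\<^sub>m\<close> in a product of two formal sums that is expanded by the rules
  \<open>u\<^sub>k b = S k b u\<^sub>k\<close> and \<open>u\<^sub>k u\<^sub>l = \<omega> (k, l) u\<^sub>k\<^sub>l\<close>; the term of index \<open>k\<close> has \<open>l = inv k m\<close>.
\<close>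
definition convolution :: "('g \<Rightarrow> 'b) \<Rightarrow> ('g \<Rightarrow> 'b) \<Rightarrow> 'g \<Rightarrow> 'b" where
  "convolution f g = (\<lambda>m \<in> carrier G. \<Oplus>k \<in> {k \<in> carrier G. f k \<noteq> \<zero>}.
     f k \<otimes> S k (g (inv\<^bsub>G\<^esub> k \<otimes>\<^bsub>G\<^esub> m)) \<otimes> \<omega> (k, inv\<^bsub>G\<^esub> k \<otimes>\<^bsub>G\<^esub> m))"

definition crossed_product :: "('k, 'g \<Rightarrow> 'b, 'g, 'b) ncp_bundle" where
  "crossed_product =
    \<lparr>carrier = finsupp_families G B, mult = convolution, one = single \<one> \<one>\<^bsub>G\<^esub>,
     zero = (\<lambda>k \<in> carrier G. \<zero>), add = (\<lambda>f g. \<lambda>k \<in> carrier G. f k \<oplus> g k),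
     smult = (\<lambda>a f. \<lambda>k \<in> carrier G. a \<odot> f k),
     grade = (\<lambda>k. (\<lambda>b. single b k) ` carrier B), base_emb = (\<lambda>b. single b \<one>\<^bsub>G\<^esub>)\<rparr>"

abbreviation "C \<equiv> crossed_product"

lemma S_hom: "k \<in> carrier G \<Longrightarrow> S k \<in> alg_hom K B B"
  and S_bij: "k \<in> carrier G \<Longrightarrow> bij_betw (S k) (carrier B) (carrier B)"
  and S_ext: "S \<in> extensional (carrier G)" "k \<in> carrier G \<Longrightarrow> S k \<in> extensional (carrier B)"
  and \<omega>_ext: "\<omega> \<in> extensional (carrier G \<times> carrier G)"
  and \<omega>_Units: "\<lbrakk>k \<in> carrier G; l \<in> carrier G\<rbrakk> \<Longrightarrow> \<omega> (k, l) \<in> Units B"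
  and \<omega>_closed [simp]: "\<lbrakk>k \<in> carrier G; l \<in> carrier G\<rbrakk> \<Longrightarrow> \<omega> (k, l) \<in> carrier B"
  and S_unit [simp]: "b \<in> carrier B \<Longrightarrow> S \<one>\<^bsub>G\<^esub> b = b"
  and \<omega>_unit [simp]: "k \<in> carrier G \<Longrightarrow> \<omega> (k, \<one>\<^bsub>G\<^esub>) = \<one>" "k \<in> carrier G \<Longrightarrow> \<omega> (\<one>\<^bsub>G\<^esub>, k) = \<one>"
  and S_S: "\<lbrakk>k \<in> carrier G; l \<in> carrier G; b \<in> carrier B\<rbrakk>
    \<Longrightarrow> S k (S l b) \<otimes> \<omega> (k, l) = \<omega> (k, l) \<otimes> S (k \<otimes>\<^bsub>G\<^esub> l) b"
  and cocycle: "\<lbrakk>k \<in> carrier G; l \<in> carrier G; m \<in> carrier G\<rbrakk>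
    \<Longrightarrow> S k (\<omega> (l, m)) \<otimes> \<omega> (k, l \<otimes>\<^bsub>G\<^esub> m) = \<omega> (k, l) \<otimes> \<omega> (k \<otimes>\<^bsub>G\<^esub> l, m)"
  using factor_system by (auto simp: factor_systems_iff Bij_def)

lemma S_closed [simp]: "\<lbrakk>k \<in> carrier G; b \<in> carrier B\<rbrakk> \<Longrightarrow> S k b \<in> carrier B"
  using alg_homD(1)[OF S_hom] .

lemmas S_simps = alg_homD(2-5)[OF S_hom]

lemma S_zero [simp]: "k \<in> carrier G \<Longrightarrow> S k \<zero> = \<zero>"
  using S_simps(1)[of k \<zero> \<zero>] by simp

lemma familyD:
  assumes "f \<in> finsupp_families G B"
  shows "k \<in> carrier G \<Longrightarrow> f k \<in> carrier B" and "f \<in> extensional (carrier G)"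
    and "finite {k \<in> carrier G. f k \<noteq> \<zero>}"
  using assms by (auto simp: finsupp_families_def PiE_iff)

lemma family_eqI:
  assumes "f \<in> finsupp_families G B" "g \<in> finsupp_families G B" "\<And>k. k \<in> carrier G \<Longrightarrow> f k = g k"
  shows "f = g"
  using familyD(2)[OF assms(1)] familyD(2)[OF assms(2)] assms(3) by (rule extensionalityI)

lemma single_family: "b \<in> carrier B \<Longrightarrow> single b k \<in> finsupp_families G B"
  by (auto simp: finsupp_families_def single_def intro: finite_subset[of _ "{k}"])

lemma family_pointwise:
  assumes f: "f \<in> finsupp_families G B" and g: "g \<in> finsupp_families G B"
    and h: "\<And>x y. \<lbrakk>x \<in> carrier B; y \<in> carrier B\<rbrakk> \<Longrightarrow> h x y \<in> carrier B" and "h \<zero> \<zero> = \<zero>"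
  shows "(\<lambda>k \<in> carrier G. h (f k) (g k)) \<in> finsupp_families G B"
proof -
  have "{k \<in> carrier G. h (f k) (g k) \<noteq> \<zero>} \<subseteq> {k \<in> carrier G. f k \<noteq> \<zero>} \<union> {k \<in> carrier G. g k \<noteq> \<zero>}"
    using assms(4) by auto
  then have "finite {k \<in> carrier G. h (f k) (g k) \<noteq> \<zero>}"
    using familyD(3)[OF f] familyD(3)[OF g] finite_subset by blast
  moreover have "{k \<in> carrier G. (\<lambda>k \<in> carrier G. h (f k) (g k)) k \<noteq> \<zero>} = {k \<in> carrier G. h (f k) (g k) \<noteq> \<zero>}"
    by auto
  ultimately show ?thesis
    using h familyD(1)[OF f] familyD(1)[OF g] by (auto simp: finsupp_families_def)
qed

lemma add_family: "\<lbrakk>f \<in> carrier C; g \<in> carrier C\<rbrakk> \<Longrightarrow> f \<oplus>\<^bsub>C\<^esub> g \<in> carrier C"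
  using family_pointwise[of f g "(\<oplus>)"] by (simp add: crossed_product_def)

lemma smult_family: "\<lbrakk>a \<in> carrier K; f \<in> carrier C\<rbrakk> \<Longrightarrow> a \<odot>\<^bsub>C\<^esub> f \<in> carrier C"
  using family_pointwise[of f f "\<lambda>x y. a \<odot> x"] by (simp add: crossed_product_def)

lemma apply_closed: "\<lbrakk>f \<in> carrier C; k \<in> carrier G\<rbrakk> \<Longrightarrow> f k \<in> carrier B"
  using familyD(1) by (simp add: crossed_product_def)

lemma apply_add: "k \<in> carrier G \<Longrightarrow> (f \<oplus>\<^bsub>C\<^esub> g) k = f k \<oplus> g k"
  and apply_zero: "k \<in> carrier G \<Longrightarrow> \<zero>\<^bsub>C\<^esub> k = \<zero>"
  and apply_smult: "k \<in> carrier G \<Longrightarrow> (a \<odot>\<^bsub>C\<^esub> f) k = a \<odot> f k"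
  and apply_single: "l \<in> carrier G \<Longrightarrow> single b k l = (if l = k then b else \<zero>)"
  by (simp_all add: crossed_product_def single_def)

lemma crossed_product_eqI:
  "\<lbrakk>f \<in> carrier C; g \<in> carrier C; \<And>k. k \<in> carrier G \<Longrightarrow> f k = g k\<rbrakk> \<Longrightarrow> f = g"
  using family_eqI by (simp add: crossed_product_def)

lemma single_closed: "b \<in> carrier B \<Longrightarrow> single b k \<in> carrier C"
  using single_family by (simp add: crossed_product_def)

lemma zero_eq_single: "\<zero>\<^bsub>C\<^esub> = single \<zero> k"
  by (auto simp: crossed_product_def single_def)

lemma zero_family: "\<zero>\<^bsub>C\<^esub> \<in> carrier C"
  using single_closed[of \<zero> "\<one>\<^bsub>G\<^esub>"] by (simp flip: zero_eq_single)

lemma crossed_product_abelian_group: "abelian_group C"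
proof (rule abelian_groupI)
  fix f assume f: "f \<in> carrier C"
  have "(\<lambda>k \<in> carrier G. \<ominus> f k) \<in> carrier C"
    using f family_pointwise[of f f "\<lambda>x y. \<ominus> x"] by (simp add: crossed_product_def)
  moreover have "(\<lambda>k \<in> carrier G. \<ominus> f k) \<oplus>\<^bsub>C\<^esub> f = \<zero>\<^bsub>C\<^esub>"
    using apply_closed[OF f] by (auto simp: crossed_product_def B.l_neg)
  ultimately show "\<exists>g \<in> carrier C. g \<oplus>\<^bsub>C\<^esub> f = \<zero>\<^bsub>C\<^esub>"
    by blast
next
  fix f assume f: "f \<in> carrier C"
  show "\<zero>\<^bsub>C\<^esub> \<oplus>\<^bsub>C\<^esub> f = f"
    by (rule crossed_product_eqI) (simp_all add: f add_family zero_family apply_add apply_zero apply_closed)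
  fix g assume g: "g \<in> carrier C"
  show "f \<oplus>\<^bsub>C\<^esub> g = g \<oplus>\<^bsub>C\<^esub> f"
    by (rule crossed_product_eqI) (simp_all add: f g add_family apply_add apply_closed B.a_comm)
  fix h assume h: "h \<in> carrier C"
  show "f \<oplus>\<^bsub>C\<^esub> g \<oplus>\<^bsub>C\<^esub> h = f \<oplus>\<^bsub>C\<^esub> (g \<oplus>\<^bsub>C\<^esub> h)"
    by (rule crossed_product_eqI) (simp_all add: f g h add_family apply_add apply_closed B.a_assoc)
qed (simp_all add: add_family zero_family)

sublocale C: abelian_group C
  by (rule crossed_product_abelian_group)

lemma crossed_product_module: "module K C"
  by (rule moduleI; (rule B.is_cring crossed_product_abelian_group crossed_product_eqI)?)
    (simp_all add: smult_family apply_smult apply_add apply_closed B.smult_l_distr B.smult_r_distr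
      B.smult_assoc1 B.is_cring)

text \<open>
  Every family is a finite sum of monomials.  All operations of the crossed product are additive in
  each argument, so the ring laws have to be verified for monomials only, where no sums occur.
\<close>
lemma family_induct [consumes 1, case_names single add]:
  assumes f: "f \<in> carrier C"
    and single: "\<And>b k. \<lbrakk>b \<in> carrier B; k \<in> carrier G\<rbrakk> \<Longrightarrow> P (single b k)"
    and add: "\<And>f g. \<lbrakk>f \<in> carrier C; g \<in> carrier C; P f; P g\<rbrakk> \<Longrightarrow> P (f \<oplus>\<^bsub>C\<^esub> g)"
  shows "P f"
proof -
  have "P f" if "finite I" "I \<subseteq> carrier G" "f \<in> carrier C" "\<forall>k \<in> carrier G - I. f k = \<zero>" for I f
    using that
  proof (induction I arbitrary: f rule: finite_induct)
    case empty
    then have "f = \<zero>\<^bsub>C\<^esub>"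
      by (intro crossed_product_eqI) (simp_all add: zero_family apply_zero)
    then show ?case
      using single[of \<zero> "\<one>\<^bsub>G\<^esub>"] zero_eq_single by simp
  next
    case (insert k I)
    \<comment> \<open>the family \<open>f\<close> without its term of degree \<open>k\<close>\<close>
    define f' where "f' = (\<lambda>l \<in> carrier G. if l = k then \<zero> else f l)"
    have apply_f': "f' l = (if l = k then \<zero> else f l)" if "l \<in> carrier G" for l
      using that by (simp add: f'_def)
    have k: "k \<in> carrier G"
      using insert by simp
    have "{l \<in> carrier G. f' l \<noteq> \<zero>} \<subseteq> I"
      using insert by (auto simp: f'_def)
    then have f': "f' \<in> carrier C"
      using insert.prems(2) apply_closed[OF insert.prems(2)] finite_subset[OF _ insert.hyps(1)]
      by (auto simp: crossed_product_def finsupp_families_def f'_def)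
    have "P f'"
      using insert f' by (intro insert.IH) (auto simp: apply_f')
    moreover have "single (f k) k \<oplus>\<^bsub>C\<^esub> f' = f"
      using k insert.prems(2) f'
      by (intro crossed_product_eqI)
        (simp_all add: add_family single_closed apply_closed apply_add apply_single apply_f')
    ultimately show ?case
      using add[of "single (f k) k" f'] single[of "f k" k] f' k insert.prems(2)
      by (simp add: single_closed apply_closed)
  qed
  from this[of "{k \<in> carrier G. f k \<noteq> \<zero>}"] f show ?thesis
    using familyD(3)[of f] by (simp add: crossed_product_def)
qed

abbreviation "conv_term f g m k \<equiv>
  f k \<otimes> S k (g (inv\<^bsub>G\<^esub> k \<otimes>\<^bsub>G\<^esub> m)) \<otimes> \<omega> (k, inv\<^bsub>G\<^esub> k \<otimes>\<^bsub>G\<^esub> m)"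

text \<open>
  The index set may be larger than the support of \<open>f\<close>, so that products of different families can be
  compared on a common index set.
\<close>
lemma apply_mult:
  assumes f: "f \<in> carrier C" and g: "g \<in> carrier C" and m: "m \<in> carrier G"
    and I: "finite I" "I \<subseteq> carrier G" "{k \<in> carrier G. f k \<noteq> \<zero>} \<subseteq> I"
  shows "(f \<otimes>\<^bsub>C\<^esub> g) m = (\<Oplus>k \<in> I. conv_term f g m k)"
proof -
  have "(\<Oplus>k \<in> I. conv_term f g m k) = (\<Oplus>k \<in> {k \<in> carrier G. f k \<noteq> \<zero>}. conv_term f g m k)"
    using I m by (intro B.add.finprod_mono_neutral_cong_right)
      (auto simp: apply_closed[OF f] apply_closed[OF g] subset_iff)
  then show ?thesis
    using m by (simp add: crossed_product_def convolution_def)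
qed

lemma mult_family:
  assumes f: "f \<in> carrier C" and g: "g \<in> carrier C"
  shows "f \<otimes>\<^bsub>C\<^esub> g \<in> carrier C"
proof -
  let ?I = "{k \<in> carrier G. f k \<noteq> \<zero>}" and ?J = "{k \<in> carrier G. g k \<noteq> \<zero>}"
  have fin: "finite ?I" "finite ?J"
    using f g familyD(3) by (simp_all add: crossed_product_def)
  have val: "(f \<otimes>\<^bsub>C\<^esub> g) m = (\<Oplus>k \<in> ?I. conv_term f g m k)" if "m \<in> carrier G" for m
    using apply_mult[OF f g that fin(1)] by simp
  have "m \<in> (\<lambda>(k, l). k \<otimes>\<^bsub>G\<^esub> l) ` (?I \<times> ?J)" if m: "m \<in> carrier G" and nz: "(f \<otimes>\<^bsub>C\<^esub> g) m \<noteq> \<zero>" for m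
  proof -
    obtain k where k: "k \<in> ?I" "conv_term f g m k \<noteq> \<zero>"
      using nz val[OF m] B.add.finprod_one_eqI[of ?I "conv_term f g m"] by fastforce
    have "g (inv\<^bsub>G\<^esub> k \<otimes>\<^bsub>G\<^esub> m) \<noteq> \<zero>"
      using k m apply_closed[OF f] by auto
    then have "(k, inv\<^bsub>G\<^esub> k \<otimes>\<^bsub>G\<^esub> m) \<in> ?I \<times> ?J" "m = k \<otimes>\<^bsub>G\<^esub> (inv\<^bsub>G\<^esub> k \<otimes>\<^bsub>G\<^esub> m)"
      using k m by (auto simp: G.m_assoc[symmetric])
    then show ?thesis
      by (force simp: image_iff)
  qed
  then have "{m \<in> carrier G. (f \<otimes>\<^bsub>C\<^esub> g) m \<noteq> \<zero>} \<subseteq> (\<lambda>(k, l). k \<otimes>\<^bsub>G\<^esub> l) ` (?I \<times> ?J)"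
    by blast
  then have "finite {m \<in> carrier G. (f \<otimes>\<^bsub>C\<^esub> g) m \<noteq> \<zero>}"
    by (rule finite_subset) (use fin in simp)
  moreover have "(f \<otimes>\<^bsub>C\<^esub> g) m \<in> carrier B" if "m \<in> carrier G" for m
    using that by (auto simp: val apply_closed[OF f] apply_closed[OF g] intro!: B.finsum_closed)
  moreover have "f \<otimes>\<^bsub>C\<^esub> g \<in> extensional (carrier G)"
    by (simp add: crossed_product_def convolution_def)
  ultimately show ?thesis
    by (auto simp: crossed_product_def finsupp_families_def PiE_iff)
qed

lemma apply_single_mult:
  assumes b: "b \<in> carrier B" and k: "k \<in> carrier G" and g: "g \<in> carrier C" and m: "m \<in> carrier G"
  shows "(single b k \<otimes>\<^bsub>C\<^esub> g) m
    = b \<otimes> S k (g (inv\<^bsub>G\<^esub> k \<otimes>\<^bsub>G\<^esub> m)) \<otimes> \<omega> (k, inv\<^bsub>G\<^esub> k \<otimes>\<^bsub>G\<^esub> m)"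
proof -
  have "(single b k \<otimes>\<^bsub>C\<^esub> g) m = (\<Oplus>l \<in> {k}. conv_term (single b k) g m l)"
    using assms by (intro apply_mult single_closed) (auto simp: single_def)
  then show ?thesis
    using assms by (simp add: apply_single apply_closed B.m_assoc)
qed

lemma single_mult_single:
  assumes "b \<in> carrier B" "c \<in> carrier B" and k: "k \<in> carrier G" and l: "l \<in> carrier G"
  shows "single b k \<otimes>\<^bsub>C\<^esub> single c l = single (b \<otimes> S k c \<otimes> \<omega> (k, l)) (k \<otimes>\<^bsub>G\<^esub> l)"
proof (rule crossed_product_eqI)
  fix m assume m: "m \<in> carrier G"
  have "inv\<^bsub>G\<^esub> k \<otimes>\<^bsub>G\<^esub> m = l \<longleftrightarrow> m = k \<otimes>\<^bsub>G\<^esub> l"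
    using k l m by (simp add: G.inv_solve_left')
  then show "(single b k \<otimes>\<^bsub>C\<^esub> single c l) m = single (b \<otimes> S k c \<otimes> \<omega> (k, l)) (k \<otimes>\<^bsub>G\<^esub> l) m"
    using assms m by (auto simp: apply_single_mult single_closed apply_single)
qed (simp_all add: assms mult_family single_closed)

lemma mult_add_left:
  assumes f: "f \<in> carrier C" and g: "g \<in> carrier C" and h: "h \<in> carrier C"
  shows "(f \<oplus>\<^bsub>C\<^esub> g) \<otimes>\<^bsub>C\<^esub> h = f \<otimes>\<^bsub>C\<^esub> h \<oplus>\<^bsub>C\<^esub> g \<otimes>\<^bsub>C\<^esub> h"
proof (rule crossed_product_eqI)
  fix m assume m: "m \<in> carrier G"
  let ?I = "{k \<in> carrier G. f k \<noteq> \<zero>} \<union> {k \<in> carrier G. g k \<noteq> \<zero>}"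
  have I: "finite ?I" "?I \<subseteq> carrier G"
    using f g familyD(3) by (auto simp: crossed_product_def)
  have "((f \<oplus>\<^bsub>C\<^esub> g) \<otimes>\<^bsub>C\<^esub> h) m = (\<Oplus>k \<in> ?I. conv_term (f \<oplus>\<^bsub>C\<^esub> g) h m k)"
    using f g h m I by (intro apply_mult add_family) (auto simp: apply_add)
  also have "\<dots> = (\<Oplus>k \<in> ?I. conv_term f h m k \<oplus> conv_term g h m k)"
    using f g h m by (intro B.finsum_cong') (auto simp: apply_add apply_closed B.l_distr)
  also have "\<dots> = (\<Oplus>k \<in> ?I. conv_term f h m k) \<oplus> (\<Oplus>k \<in> ?I. conv_term g h m k)"
    using f g h m by (intro B.finsum_addf) (auto simp: apply_closed)
  also have "\<dots> = (f \<otimes>\<^bsub>C\<^esub> h) m \<oplus> (g \<otimes>\<^bsub>C\<^esub> h) m"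
    using apply_mult[OF f h m I] apply_mult[OF g h m I] by auto
  finally show "((f \<oplus>\<^bsub>C\<^esub> g) \<otimes>\<^bsub>C\<^esub> h) m = (f \<otimes>\<^bsub>C\<^esub> h \<oplus>\<^bsub>C\<^esub> g \<otimes>\<^bsub>C\<^esub> h) m"
    using m by (simp add: apply_add)
qed (simp_all add: assms mult_family add_family)

lemma mult_add_right:
  assumes f: "f \<in> carrier C" and g: "g \<in> carrier C" and h: "h \<in> carrier C"
  shows "h \<otimes>\<^bsub>C\<^esub> (f \<oplus>\<^bsub>C\<^esub> g) = h \<otimes>\<^bsub>C\<^esub> f \<oplus>\<^bsub>C\<^esub> h \<otimes>\<^bsub>C\<^esub> g"
  using h
proof (induction h rule: family_induct)
  case (single b k)
  then show ?case
    using f g by (intro crossed_product_eqI)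
      (simp_all add: mult_family add_family single_closed apply_add apply_single_mult apply_closed
        S_simps B.l_distr B.r_distr)
next
  case (add h h')
  then show ?case
    using f g by (simp add: mult_add_left add_family mult_family C.a_ac)
qed

text \<open>
  For monomials, associativity is the commutation rule for \<open>S k\<close> and \<open>S l\<close> followed by the cocycle
  identity for \<open>\<omega>\<close>.
\<close>
lemma crossed_product_assoc:
  assumes f: "f \<in> carrier C" and g: "g \<in> carrier C" and h: "h \<in> carrier C"
  shows "f \<otimes>\<^bsub>C\<^esub> g \<otimes>\<^bsub>C\<^esub> h = f \<otimes>\<^bsub>C\<^esub> (g \<otimes>\<^bsub>C\<^esub> h)"
  using f
proof (induction f rule: family_induct)
  case (single b k)
  note b = single
  show ?case
    using g
  proof (induction g rule: family_induct)
    case (single c l)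
    note c = single
    show ?case
      using h
    proof (induction h rule: family_induct)
      case (single d m)
      note d = single
      \<comment> \<open>the coefficients of the two triple products of monomials\<close>
      have "b \<otimes> S k c \<otimes> \<omega> (k, l) \<otimes> S (k \<otimes>\<^bsub>G\<^esub> l) d \<otimes> \<omega> (k \<otimes>\<^bsub>G\<^esub> l, m)
          = b \<otimes> S k c \<otimes> (\<omega> (k, l) \<otimes> S (k \<otimes>\<^bsub>G\<^esub> l) d) \<otimes> \<omega> (k \<otimes>\<^bsub>G\<^esub> l, m)"
        using b c d by (simp add: B.m_assoc)
      also have "\<dots> = b \<otimes> S k c \<otimes> S k (S l d) \<otimes> (\<omega> (k, l) \<otimes> \<omega> (k \<otimes>\<^bsub>G\<^esub> l, m))"
        using b c d by (simp add: B.m_assoc flip: S_S)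
      also have "\<dots> = b \<otimes> S k (c \<otimes> S l d \<otimes> \<omega> (l, m)) \<otimes> \<omega> (k, l \<otimes>\<^bsub>G\<^esub> m)"
        using b c d by (simp add: B.m_assoc S_simps flip: cocycle)
      finally show ?case
        using b c d by (simp add: single_mult_single G.m_assoc)
    next
      case (add h h')
      then show ?case
        using b c by (simp add: mult_add_right mult_family single_closed)
    qed
  next
    case (add g g')
    then show ?case
      using b h by (simp add: mult_add_right mult_add_left mult_family single_closed)
  qed
next
  case (add f f')
  then show ?case
    using g h by (simp add: mult_add_left mult_family)
qed

lemma one_mult: "f \<in> carrier C \<Longrightarrow> \<one>\<^bsub>C\<^esub> \<otimes>\<^bsub>C\<^esub> f = f"
proof -
  have "single \<one> \<one>\<^bsub>G\<^esub> \<otimes>\<^bsub>C\<^esub> f = f" if "f \<in> carrier C"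
    using that
    by (induction rule: family_induct) (simp_all add: single_mult_single mult_add_right single_closed)
  then show "f \<in> carrier C \<Longrightarrow> \<one>\<^bsub>C\<^esub> \<otimes>\<^bsub>C\<^esub> f = f"
    by (simp add: crossed_product_def)
qed

lemma mult_one: "f \<in> carrier C \<Longrightarrow> f \<otimes>\<^bsub>C\<^esub> \<one>\<^bsub>C\<^esub> = f"
proof -
  have "f \<otimes>\<^bsub>C\<^esub> single \<one> \<one>\<^bsub>G\<^esub> = f" if "f \<in> carrier C"
    using that
    by (induction rule: family_induct) (simp_all add: single_mult_single mult_add_left single_closed S_simps)
  then show "f \<in> carrier C \<Longrightarrow> f \<otimes>\<^bsub>C\<^esub> \<one>\<^bsub>C\<^esub> = f"
    by (simp add: crossed_product_def)
qed

lemma single_smult: "\<lbrakk>a \<in> carrier K; b \<in> carrier B\<rbrakk> \<Longrightarrow> a \<odot>\<^bsub>C\<^esub> single b k = single (a \<odot> b) k"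
  by (intro crossed_product_eqI) (simp_all add: smult_family single_closed apply_smult apply_single)

lemma single_add: "\<lbrakk>b \<in> carrier B; c \<in> carrier B\<rbrakk> \<Longrightarrow> single b k \<oplus>\<^bsub>C\<^esub> single c k = single (b \<oplus> c) k"
  by (intro crossed_product_eqI) (simp_all add: add_family single_closed apply_add apply_single)

lemma crossed_product_unital_algebra: "unital_algebra K C"
proof -
  interpret M: module K C
    by (rule crossed_product_module)
  have smult: "(a \<odot>\<^bsub>C\<^esub> f) \<otimes>\<^bsub>C\<^esub> g = a \<odot>\<^bsub>C\<^esub> (f \<otimes>\<^bsub>C\<^esub> g) \<and> f \<otimes>\<^bsub>C\<^esub> (a \<odot>\<^bsub>C\<^esub> g) = a \<odot>\<^bsub>C\<^esub> (f \<otimes>\<^bsub>C\<^esub> g)"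
    if a: "a \<in> carrier K" and f: "f \<in> carrier C" and g: "g \<in> carrier C" for a f g
    using f
  proof (induction f rule: family_induct)
    case (single b k)
    note b = single
    show ?case
      using g
    proof (induction g rule: family_induct)
      case (single c l)
      then show ?case
        using a b by (simp add: single_smult single_mult_single S_simps B.smult_mult_left B.smult_mult_right)
    next
      case (add g g')
      then show ?case
        using a b by (simp add: mult_add_right mult_family single_closed smult_family M.smult_r_distr)
    qed
  next
    case (add f f')
    then show ?case
      using a g by (simp add: mult_add_left mult_family smult_family M.smult_r_distr)
  qed
  have "ring C"
    by (rule ringI)
      (simp_all add: crossed_product_abelian_group mult_add_left mult_add_right, rule monoidI,
        simp_all add: mult_family crossed_product_assoc one_mult mult_one, simp add: crossed_product_def single_family)
  then show ?thesis
    by (intro unital_algebra.intro crossed_product_module unital_algebra_axioms.intro)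
      (simp_all add: smult)
qed

end


section \<open>The crossed product as a bundle\<close>

context crossed_product_data
begin

lemma finsum_apply:
  assumes "\<And>i. i \<in> I \<Longrightarrow> y i \<in> carrier C" and m: "m \<in> carrier G"
  shows "finsum C y I m = (\<Oplus>i \<in> I. y i m)"
  using assms
  by (intro finsum_additive[where h = "\<lambda>f. f m", OF crossed_product_abelian_group B.is_abelian_group])
    (auto simp: apply_closed apply_add)

text \<open>
  Evaluation at \<open>m\<close> is additive and kills the monomials of all other degrees.  So a sum of monomials of
  distinct degrees can be recovered from its values, which is the uniqueness part of the direct sum
  decomposition.
\<close>
lemma sum_homogeneous_apply:
  assumes y: "\<And>k. k \<in> I \<Longrightarrow> y k \<in> grade C k" and I: "finite I" "I \<subseteq> carrier G" and m: "m \<in> carrier G"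
  shows "finsum C y I m = (if m \<in> I then y m m else \<zero>)"
proof -
  have y': "\<exists>b \<in> carrier B. y k = single b k" if "k \<in> I" for k
    using y[OF that] by (auto simp: crossed_product_def)
  have yc: "y k \<in> carrier C" if "k \<in> I" for k
    using y'[OF that] single_closed by auto
  have "finsum C y I m = (\<Oplus>k \<in> I. y k m)"
    by (rule finsum_apply[OF yc m])
  also have "\<dots> = (\<Oplus>k \<in> I. if m = k then y k m else \<zero>)"
  proof (rule B.finsum_cong')
    fix k assume k: "k \<in> I"
    then show "y k m = (if m = k then y k m else \<zero>)"
      using y'[OF k] m by (auto simp: apply_single)
  qed (use yc m in \<open>auto simp: apply_closed\<close>)
  also have "\<dots> = (if m \<in> I then y m m else \<zero>)"
  proof (cases "m \<in> I")
    case True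
    then show ?thesis
      using B.finsum_singleton[of m I "\<lambda>k. y k m"] I yc m by (simp add: apply_closed)
  next
    case False
    then have "(\<Oplus>k \<in> I. if m = k then y k m else \<zero>) = (\<Oplus>k \<in> I. \<zero>)"
      by (intro B.finsum_cong') auto
    then show ?thesis
      using False by simp
  qed
  finally show ?thesis .
qed

lemma single_in_grade: "b \<in> carrier B \<Longrightarrow> single b k \<in> grade C k"
  by (simp add: crossed_product_def)

lemma crossed_product_direct_sum:
  assumes f: "f \<in> carrier C"
  shows "\<exists>!y. y \<in> (\<Pi>\<^sub>E k \<in> carrier G. grade C k) \<and> finite {k \<in> carrier G. y k \<noteq> \<zero>\<^bsub>C\<^esub>} \<and>
    f = (\<Oplus>\<^bsub>C\<^esub>k \<in> {k \<in> carrier G. y k \<noteq> \<zero>\<^bsub>C\<^esub>}. y k)"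
proof (rule ex1I)
  define y where "y = (\<lambda>k \<in> carrier G. single (f k) k)"
  let ?I = "{k \<in> carrier G. y k \<noteq> \<zero>\<^bsub>C\<^esub>}"
  have nz: "single (f k) k \<noteq> \<zero>\<^bsub>C\<^esub> \<longleftrightarrow> f k \<noteq> \<zero>" if "k \<in> carrier G" for k
    using that apply_single[of k "f k" k] apply_zero[of k] by (auto simp flip: zero_eq_single)
  then have I: "?I = {k \<in> carrier G. f k \<noteq> \<zero>}"
    by (auto simp: y_def)
  then have fin: "finite ?I"
    using f familyD(3) by (simp add: crossed_product_def)
  have yg: "y k \<in> grade C k" if "k \<in> carrier G" for k
    using that apply_closed[OF f] by (simp add: y_def single_in_grade)
  have y_ext: "y \<in> extensional (carrier G)"
    by (simp add: y_def)
  have "f = finsum C y ?I"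
  proof (rule crossed_product_eqI)
    show "finsum C y ?I \<in> carrier C"
      using apply_closed[OF f] by (intro C.finsum_closed) (auto simp: y_def single_closed)
    fix m assume m: "m \<in> carrier G"
    have "finsum C y ?I m = (if m \<in> ?I then y m m else \<zero>)"
      using yg by (intro sum_homogeneous_apply fin m) auto
    then show "f m = finsum C y ?I m"
      using m unfolding I by (auto simp: y_def apply_single)
  qed fact
  then show "y \<in> (\<Pi>\<^sub>E k \<in> carrier G. grade C k) \<and> finite ?I \<and> f = (\<Oplus>\<^bsub>C\<^esub>k \<in> ?I. y k)"
    using yg fin y_ext by (auto simp: PiE_iff)
  fix z assume z: "z \<in> (\<Pi>\<^sub>E k \<in> carrier G. grade C k) \<and> finite {k \<in> carrier G. z k \<noteq> \<zero>\<^bsub>C\<^esub>} \<and>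
    f = (\<Oplus>\<^bsub>C\<^esub>k \<in> {k \<in> carrier G. z k \<noteq> \<zero>\<^bsub>C\<^esub>}. z k)"
  have "z k = single (f k) k" if k: "k \<in> carrier G" for k
  proof -
    obtain b where b: "b \<in> carrier B" "z k = single b k"
      using z k by (auto simp: crossed_product_def)
    have "finsum C z {k \<in> carrier G. z k \<noteq> \<zero>\<^bsub>C\<^esub>} k
      = (if k \<in> {k \<in> carrier G. z k \<noteq> \<zero>\<^bsub>C\<^esub>} then z k k else \<zero>)"
      using z by (intro sum_homogeneous_apply k) auto
    then have "f k = (if k \<in> {k \<in> carrier G. z k \<noteq> \<zero>\<^bsub>C\<^esub>} then z k k else \<zero>)"
      using z by auto
    also have "\<dots> = b"
      using k b apply_single[of k b k] apply_zero[of k] by auto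
    finally show ?thesis
      using b by simp
  qed
  moreover have "z \<in> extensional (carrier G)"
    using z by (auto simp: PiE_iff)
  ultimately show "z = y"
    using y_ext by (intro extensionalityI[of z "carrier G" y]) (simp_all add: y_def)
qed

text \<open>
  Surjectivity of \<open>S k\<close> provides a right inverse of degree \<open>inv k\<close>, and invertibility of the cocycle
  provides a left inverse of the same degree; the two agree.
\<close>
lemma single_one_Units:
  assumes k: "k \<in> carrier G"
  shows "single \<one> k \<in> Units C"
proof -
  interpret A: unital_algebra K C
    by (rule crossed_product_unital_algebra)
  let ?l = "inv\<^bsub>G\<^esub> k"
  have l: "?l \<in> carrier G"
    using k by simp
  have "inv \<omega> (k, ?l) \<in> S k ` carrier B"
    using S_bij[OF k] \<omega>_Units[OF k l] by (simp add: bij_betw_def)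
  then obtain c where c: "c \<in> carrier B" "S k c = inv \<omega> (k, ?l)"
    by (metis imageE)
  have right: "single \<one> k \<otimes>\<^bsub>C\<^esub> single c ?l = \<one>\<^bsub>C\<^esub>"
    using k c \<omega>_Units[OF k l] by (simp add: single_mult_single, simp add: crossed_product_def)
  have left: "single (inv \<omega> (?l, k)) ?l \<otimes>\<^bsub>C\<^esub> single \<one> k = \<one>\<^bsub>C\<^esub>"
    using k \<omega>_Units[OF l k] by (simp add: single_mult_single S_simps, simp add: crossed_product_def)
  have "single (inv \<omega> (?l, k)) ?l = single c ?l"
    using A.inv_unique[OF left right] c k \<omega>_Units[OF l k] by (simp add: single_closed)
  then show ?thesis
    using left right c by (auto simp: Units_def single_closed)
qed

lemma crossed_product_trivial_bundle: "trivial_bundle K G B C"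
proof -
  interpret A: unital_algebra K C
    by (rule crossed_product_unital_algebra)
  show ?thesis
  proof (intro trivial_bundle.intro trivial_bundle_axioms.intro crossed_product_unital_algebra)
    fix k assume k: "k \<in> carrier G"
    show "submodule (grade C k) K C"
    proof (rule A.submoduleI)
      show "grade C k \<subseteq> carrier C"
        using single_closed by (auto simp: crossed_product_def)
      show "\<zero>\<^bsub>C\<^esub> \<in> grade C k"
        using single_in_grade[of \<zero> k] by (simp flip: zero_eq_single)
      fix x assume "x \<in> grade C k"
      then obtain b where b: "b \<in> carrier B" "x = single b k"
        by (auto simp: crossed_product_def)
      have "single (\<ominus> b) k \<oplus>\<^bsub>C\<^esub> x = \<zero>\<^bsub>C\<^esub>"
        using b by (simp add: single_add B.l_neg flip: zero_eq_single)
      then have "\<ominus>\<^bsub>C\<^esub> x = single (\<ominus> b) k"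
        using b by (intro C.minus_equality) (simp_all add: single_closed)
      then show "\<ominus>\<^bsub>C\<^esub> x \<in> grade C k"
        using b by (simp add: single_in_grade)
      show "a \<odot>\<^bsub>C\<^esub> x \<in> grade C k" if "a \<in> carrier K" for a
        using b that by (simp add: single_smult single_in_grade)
      fix y assume "y \<in> grade C k"
      then obtain c where "c \<in> carrier B" "y = single c k"
        by (auto simp: crossed_product_def)
      then show "x \<oplus>\<^bsub>C\<^esub> y \<in> grade C k"
        using b by (simp add: single_add single_in_grade)
    qed
    show "grade C k \<inter> Units C \<noteq> {}"
      using single_one_Units[OF k] single_in_grade[of \<one> k] by auto
    fix l x y assume l: "l \<in> carrier G" and "x \<in> grade C k" "y \<in> grade C l"
    then obtain b c where "b \<in> carrier B" "c \<in> carrier B" "x = single b k" "y = single c l"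
      by (auto simp: crossed_product_def)
    then show "x \<otimes>\<^bsub>C\<^esub> y \<in> grade C (k \<otimes>\<^bsub>G\<^esub> l)"
      using k l by (simp add: single_mult_single single_in_grade)
  next
    have emb: "base_emb C b = single b \<one>\<^bsub>G\<^esub>" for b
      by (simp add: crossed_product_def)
    have one: "\<one>\<^bsub>C\<^esub> = single \<one> \<one>\<^bsub>G\<^esub>"
      by (simp add: crossed_product_def)
    show "base_emb C \<in> alg_hom K B C"
      by (rule alg_homI)
        (simp_all add: emb one single_closed single_add single_mult_single single_smult)
    show "bij_betw (base_emb C) (carrier B) (grade C \<one>\<^bsub>G\<^esub>)"
    proof (rule bij_betw_imageI)
      show "inj_on (base_emb C) (carrier B)"
      proof (rule inj_onI)
        fix b c assume "base_emb C b = base_emb C c"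
        then have "single b \<one>\<^bsub>G\<^esub> \<one>\<^bsub>G\<^esub> = single c \<one>\<^bsub>G\<^esub> \<one>\<^bsub>G\<^esub>"
          by (simp only: emb)
        then show "b = c"
          by (simp add: apply_single)
      qed
      show "base_emb C ` carrier B = grade C \<one>\<^bsub>G\<^esub>"
        by (simp add: crossed_product_def)
    qed
  qed (rule crossed_product_direct_sum)
qed

sublocale X: graded_bundle K G B C
  by (intro graded_bundle.intro bundle_base_axioms crossed_product_trivial_bundle)

text \<open>
  The multiplication rule for monomials, with the coefficients \<open>\<one>\<close>, is the pair of relations that
  determines the factor system of this section.
\<close>
lemma crossed_product_section:
  defines "\<sigma> \<equiv> \<lambda>k \<in> carrier G. single \<one> k"
  shows "\<sigma> \<in> homogeneous_sections G C" and "section_factor_system G B C \<sigma> = (S, \<omega>)"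
proof -
  have emb: "base_emb C b = single b \<one>\<^bsub>G\<^esub>" for b
    by (simp add: crossed_product_def)
  show \<sigma>: "\<sigma> \<in> homogeneous_sections G C"
    using single_one_Units single_in_grade by (auto simp: homogeneous_sections_def \<sigma>_def) (simp add: crossed_product_def)
  show "section_factor_system G B C \<sigma> = (S, \<omega>)"
    by (rule X.section_factor_system_eqI[OF \<sigma> S_ext \<omega>_ext])
      (simp_all add: emb \<sigma>_def single_mult_single S_simps)
qed

end


section \<open>Isomorphisms of bundles\<close>

text \<open>
  The isomorphisms in the definition of \<open>bundle_rel\<close>, but between bundles whose elements may have
  different types, as is the case for a bundle and a crossed product.
\<close>
definition bundle_iso ::
    "('k, 'm) ring_scheme \<Rightarrow> ('g, 'q) monoid_scheme \<Rightarrow> ('k, 'b, 'y) module_scheme \<Rightarrow> ('a \<Rightarrow> 'c)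
      \<Rightarrow> ('k, 'a, 'g, 'b) ncp_bundle \<Rightarrow> ('k, 'c, 'g, 'b) ncp_bundle \<Rightarrow> bool" where
  "bundle_iso K G B \<phi> A A' \<longleftrightarrow> \<phi> \<in> alg_hom K A A' \<and> bij_betw \<phi> (carrier A) (carrier A') \<and>
     (\<forall>k \<in> carrier G. \<phi> ` grade A k = grade A' k) \<and>
     (\<forall>b \<in> carrier B. \<phi> (base_emb A b) = base_emb A' b)"

context graded_bundle
begin

lemma bundle_iso_refl: "bundle_iso K G B (\<lambda>x. x) A A"
  by (auto simp: bundle_iso_def alg_hom_def ring_hom_def bij_betw_def)

lemma bundle_iso_trans:
  assumes \<phi>: "bundle_iso K G B \<phi> A A'" and \<psi>: "bundle_iso K G B \<psi> A' A''"
  shows "bundle_iso K G B (\<psi> \<circ> \<phi>) A A''"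
  unfolding bundle_iso_def
proof (intro conjI ballI)
  note h = alg_homD[of \<phi> K A A'] and h' = alg_homD[of \<psi> K A' A'']
  show "\<psi> \<circ> \<phi> \<in> alg_hom K A A''"
    using \<phi> \<psi> by (intro alg_homI) (auto simp: bundle_iso_def h h')
  show "bij_betw (\<psi> \<circ> \<phi>) (carrier A) (carrier A'')"
    using \<phi> \<psi> bij_betw_trans by (auto simp: bundle_iso_def)
  show "(\<psi> \<circ> \<phi>) ` grade A k = grade A'' k" if "k \<in> carrier G" for k
    using \<phi> \<psi> that by (auto simp: bundle_iso_def simp flip: image_image)
qed (use \<phi> \<psi> in \<open>auto simp: bundle_iso_def\<close>)

lemma bundle_iso_sym:
  assumes \<phi>: "bundle_iso K G B \<phi> A A'"
  shows "bundle_iso K G B (inv_into (carrier A) \<phi>) A' A"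
  unfolding bundle_iso_def
proof (intro conjI ballI)
  let ?\<psi> = "inv_into (carrier A) \<phi>"
  have hom: "\<phi> \<in> alg_hom K A A'" and bij: "bij_betw \<phi> (carrier A) (carrier A')"
    using \<phi> by (auto simp: bundle_iso_def)
  note h = alg_homD[OF hom]
  have \<psi>: "?\<psi> y \<in> carrier A" "\<phi> (?\<psi> y) = y" if "y \<in> carrier A'" for y
    using bij that by (auto simp: bij_betw_def intro: inv_into_into f_inv_into_f)
  have \<psi>_eq: "?\<psi> y = x" if "x \<in> carrier A" "\<phi> x = y" for x y
    using bij that by (auto simp: bij_betw_def)
  show "?\<psi> \<in> alg_hom K A' A"
    by (rule alg_homI) (auto simp: h \<psi> intro!: \<psi>_eq)
  show "bij_betw ?\<psi> (carrier A') (carrier A)"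
    using bij by (rule bij_betw_inv_into)
  show "?\<psi> ` grade A' k = grade A k" if k: "k \<in> carrier G" for k
  proof -
    have "grade A' k = \<phi> ` grade A k"
      using \<phi> k by (simp add: bundle_iso_def)
    then have "?\<psi> ` grade A' k = (\<lambda>x. ?\<psi> (\<phi> x)) ` grade A k"
      by (simp add: image_image)
    also have "\<dots> = (\<lambda>x. x) ` grade A k"
      using k grade_closed by (intro image_cong) (auto intro: \<psi>_eq)
    finally show ?thesis by simp
  qed
  show "?\<psi> (base_emb A' b) = base_emb A b" if "b \<in> carrier B" for b
    using \<phi> that by (intro \<psi>_eq base_emb_in_carrier) (auto simp: bundle_iso_def)
qed

text \<open>
  An isomorphism of bundles is the identity on \<open>B\<close>, so it preserves the two relations that determine
  the factor system of a section.
\<close>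
lemma bundle_iso_section:
  assumes \<phi>: "bundle_iso K G B \<phi> A A'" and "graded_bundle K G B A'"
    and \<sigma>: "\<sigma> \<in> homogeneous_sections G A"
  defines "\<tau> \<equiv> \<lambda>k \<in> carrier G. \<phi> (\<sigma> k)"
  shows "\<tau> \<in> homogeneous_sections G A'"
    and "section_factor_system G B A' \<tau> = section_factor_system G B A \<sigma>"
proof -
  interpret A': graded_bundle K G B A' by fact
  note s = homogeneous_sectionD[OF \<sigma>]
  have hom: "\<phi> \<in> alg_hom K A A'" and emb: "\<And>b. b \<in> carrier B \<Longrightarrow> base_emb A' b = \<phi> (base_emb A b)"
    using \<phi> by (auto simp: bundle_iso_def)
  note h = alg_homD[OF hom]
  have "\<phi> (\<sigma> k) \<in> Units A'" if k: "k \<in> carrier G" for k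
    using h(3)[of "\<sigma> k" "inv \<sigma> k"] h(3)[of "inv \<sigma> k" "\<sigma> k"] h(1)[of "\<sigma> k"] h(1)[of "inv \<sigma> k"] s(2,3)[OF k]
    unfolding Units_def[of A'] by (auto simp: h(4) intro!: bexI[of _ "\<phi> (inv \<sigma> k)"])
  moreover have "\<phi> (\<sigma> k) \<in> grade A' k" if k: "k \<in> carrier G" for k
    using \<phi> k s(1)[OF k] by (auto simp: bundle_iso_def)
  ultimately show \<tau>: "\<tau> \<in> homogeneous_sections G A'"
    by (auto simp: \<tau>_def homogeneous_sections_def s(4) h(4))
  obtain S \<omega> where eq: "section_factor_system G B A \<sigma> = (S, \<omega>)"
    by fastforce
  note D = section_factor_systemD[OF \<sigma> eq]
  show "section_factor_system G B A' \<tau> = section_factor_system G B A \<sigma>"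
    unfolding eq
    by (rule A'.section_factor_system_eqI[OF \<tau> D(5)[OF G.one_closed] D(6) D(7)[OF G.one_closed]])
      (simp_all add: \<tau>_def emb D B.Units_closed[OF D(3)] s base_emb_in_carrier flip: h(3))
qed

lemma bundle_iso_char_class:
  assumes \<phi>: "bundle_iso K G B \<phi> A A'" and A': "graded_bundle K G B A'"
  shows "char_class K G B A = char_class K G B A'"
proof -
  interpret A': graded_bundle K G B A' by fact
  show ?thesis
    unfolding char_class_eq A'.char_class_eq
    using bundle_iso_section[OF \<phi> A'] A'.bundle_iso_section[OF bundle_iso_sym[OF \<phi>] graded_bundle_axioms]
    by (intro subset_antisym image_subsetI) (metis imageI)+
qed

end


section \<open>Transport of structure and the crossed product by a section\<close>

context graded_bundle
begin

text \<open>
  Here \<open>A'\<close> is only a record of operations: the axioms of a bundle pass to it along the bijection.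
  For the direct sum decomposition, a decomposition in \<open>A'\<close> is pulled back to \<open>A\<close>, where it is
  known to consist of the components.
\<close>
lemma bundle_transfer:
  fixes A' :: "('k, 'c, 'g, 'b) ncp_bundle"
  assumes bij: "bij_betw \<phi> (carrier A) (carrier A')"
    and mult: "\<And>x y. \<lbrakk>x \<in> carrier A; y \<in> carrier A\<rbrakk> \<Longrightarrow> \<phi> x \<otimes>\<^bsub>A'\<^esub> \<phi> y = \<phi> (x \<otimes> y)"
    and add: "\<And>x y. \<lbrakk>x \<in> carrier A; y \<in> carrier A\<rbrakk> \<Longrightarrow> \<phi> x \<oplus>\<^bsub>A'\<^esub> \<phi> y = \<phi> (x \<oplus> y)"
    and smult: "\<And>a x. \<lbrakk>a \<in> carrier K; x \<in> carrier A\<rbrakk> \<Longrightarrow> a \<odot>\<^bsub>A'\<^esub> \<phi> x = \<phi> (a \<odot> x)"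
    and one: "\<one>\<^bsub>A'\<^esub> = \<phi> \<one>" and zero: "\<zero>\<^bsub>A'\<^esub> = \<phi> \<zero>"
    and grade: "\<And>k. k \<in> carrier G \<Longrightarrow> grade A' k = \<phi> ` grade A k"
    and emb: "\<And>b. b \<in> carrier B \<Longrightarrow> base_emb A' b = \<phi> (base_emb A b)"
  shows "graded_bundle K G B A'" and "bundle_iso K G B \<phi> A A'"
proof -
  have carrier: "carrier A' = \<phi> ` carrier A"
    using bij by (simp add: bij_betw_def)
  have inj: "\<phi> x = \<phi> y \<longleftrightarrow> x = y" if "x \<in> carrier A" "y \<in> carrier A" for x y
    using bij that by (auto simp: bij_betw_def inj_on_def)
  note [simp] = mult add smult one zero
  have neg: "\<exists>y \<in> carrier A. \<phi> (x \<oplus> y) = \<phi> \<zero>" if "x \<in> carrier A" for x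
    using that A.r_neg by (intro bexI[of _ "\<ominus> x"]) auto
  have group: "abelian_group A'"
    by (rule abelian_groupI) (auto simp: carrier A.a_ac neg)
  have "ring A'"
  proof (rule ringI[OF group])
    show "monoid A'"
      by (rule monoidI) (auto simp: carrier A.m_assoc)
  qed (auto simp: carrier A.l_distr A.r_distr)
  moreover have "module K A'"
    by (rule moduleI[OF B.is_cring group])
      (auto simp: carrier A.smult_l_distr A.smult_r_distr A.smult_assoc1)
  ultimately have alg: "unital_algebra K A'"
    by (intro unital_algebra.intro unital_algebra_axioms.intro)
      (auto simp: carrier A.smult_mult_left A.smult_mult_right)
  interpret A': unital_algebra K A' by (rule alg)
  have hom: "\<phi> \<in> alg_hom K A A'"
    by (rule alg_homI) (auto simp: carrier)
  have sum: "\<phi> (finsum A f I) = (\<Oplus>\<^bsub>A'\<^esub>i \<in> I. \<phi> (f i))" if "\<And>i. i \<in> I \<Longrightarrow> f i \<in> carrier A" for f :: "'g \<Rightarrow> 'a" and I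
    using that by (intro finsum_additive[OF A.is_abelian_group group]) (auto simp: carrier)
  have "trivial_bundle K G B A'"
  proof (intro trivial_bundle.intro trivial_bundle_axioms.intro alg)
    fix k assume k: "k \<in> carrier G"
    show "submodule (grade A' k) K A'"
    proof (rule A'.submoduleI)
      show "grade A' k \<subseteq> carrier A'"
        using grade_closed k by (auto simp: grade carrier)
      show "\<zero>\<^bsub>A'\<^esub> \<in> grade A' k"
        using grade_zero k by (simp add: grade)
      fix x assume "x \<in> grade A' k"
      then obtain a where a: "a \<in> grade A k" "x = \<phi> a" "a \<in> carrier A"
        using k grade_closed by (auto simp: grade)
      have neg: "\<ominus> a \<in> grade A k"
        using A.submoduleE(3)[OF A.grade_subspace[OF k] a(1)] .
      then have "\<ominus>\<^bsub>A'\<^esub> x = \<phi> (\<ominus> a)"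
        using a by (intro A'.minus_equality) (auto simp: carrier A.l_neg)
      then show "\<ominus>\<^bsub>A'\<^esub> x \<in> grade A' k"
        using neg k by (simp add: grade)
      show "c \<odot>\<^bsub>A'\<^esub> x \<in> grade A' k" if "c \<in> carrier K" for c
        using a k that A.submoduleE(4)[OF A.grade_subspace[OF k]] by (simp add: grade)
      fix y assume "y \<in> grade A' k"
      then obtain b where "b \<in> grade A k" "y = \<phi> b" "b \<in> carrier A"
        using k grade_closed by (auto simp: grade)
      then show "x \<oplus>\<^bsub>A'\<^esub> y \<in> grade A' k"
        using a k grade_add by (simp add: grade)
    qed
    obtain u where u: "u \<in> grade A k" "u \<in> Units A"
      using A.invertible[OF k] by blast
    then have "\<phi> u \<in> Units A'"
      unfolding Units_def[of A'] by (auto simp: carrier A.Units_closed intro!: bexI[of _ "inv u"])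
    then show "grade A' k \<inter> Units A' \<noteq> {}"
      using u k by (auto simp: grade)
    fix l x y assume l: "l \<in> carrier G" and "x \<in> grade A' k" "y \<in> grade A' l"
    then show "x \<otimes>\<^bsub>A'\<^esub> y \<in> grade A' (k \<otimes>\<^bsub>G\<^esub> l)"
      using k A.grade_mult[OF k l] by (auto simp: grade grade_closed)
  next
    fix x' assume "x' \<in> carrier A'"
    then obtain x where x: "x \<in> carrier A" "x' = \<phi> x"
      by (auto simp: carrier)
    let ?c = "component x"
    have c: "?c k \<in> carrier A" if "k \<in> carrier G" for k
      using component_in_grade[OF x(1) that] grade_closed that by blast
    show "\<exists>!f. f \<in> (\<Pi>\<^sub>E k \<in> carrier G. grade A' k) \<and> finite {k \<in> carrier G. f k \<noteq> \<zero>\<^bsub>A'\<^esub>} \<and>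
      x' = (\<Oplus>\<^bsub>A'\<^esub>k \<in> {k \<in> carrier G. f k \<noteq> \<zero>\<^bsub>A'\<^esub>}. f k)"
    proof (rule ex1I)
      define f' where "f' = (\<lambda>k \<in> carrier G. \<phi> (?c k))"
      have supp': "{k \<in> carrier G. f' k \<noteq> \<zero>\<^bsub>A'\<^esub>} = {k \<in> carrier G. ?c k \<noteq> \<zero>}"
        using inj[OF c A.zero_closed] by (auto simp: f'_def)
      have d: "finite {k \<in> carrier G. ?c k \<noteq> \<zero>}" "x = (\<Oplus>k \<in> {k \<in> carrier G. ?c k \<noteq> \<zero>}. ?c k)"
        using decomposes_component[OF x(1)] by blast+
      have "x' = \<phi> (\<Oplus>k \<in> {k \<in> carrier G. ?c k \<noteq> \<zero>}. ?c k)"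
        using x(2) d(2) by simp
      also have "\<dots> = (\<Oplus>\<^bsub>A'\<^esub>k \<in> {k \<in> carrier G. ?c k \<noteq> \<zero>}. \<phi> (?c k))"
        using c by (intro sum) auto
      also have "\<dots> = (\<Oplus>\<^bsub>A'\<^esub>k \<in> {k \<in> carrier G. ?c k \<noteq> \<zero>}. f' k)"
        using c by (intro A'.finsum_cong') (auto simp: f'_def carrier)
      finally have "x' = (\<Oplus>\<^bsub>A'\<^esub>k \<in> {k \<in> carrier G. f' k \<noteq> \<zero>\<^bsub>A'\<^esub>}. f' k)"
        unfolding supp' .
      moreover have "f' \<in> (\<Pi>\<^sub>E k \<in> carrier G. grade A' k)"
        using component_in_grade[OF x(1)] by (auto simp: f'_def grade)
      moreover have "finite {k \<in> carrier G. f' k \<noteq> \<zero>\<^bsub>A'\<^esub>}"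
        using d(1) unfolding supp' .
      ultimately show "f' \<in> (\<Pi>\<^sub>E k \<in> carrier G. grade A' k) \<and> finite {k \<in> carrier G. f' k \<noteq> \<zero>\<^bsub>A'\<^esub>} \<and>
          x' = (\<Oplus>\<^bsub>A'\<^esub>k \<in> {k \<in> carrier G. f' k \<noteq> \<zero>\<^bsub>A'\<^esub>}. f' k)"
        by blast
      fix g' assume g': "g' \<in> (\<Pi>\<^sub>E k \<in> carrier G. grade A' k) \<and> finite {k \<in> carrier G. g' k \<noteq> \<zero>\<^bsub>A'\<^esub>} \<and>
          x' = (\<Oplus>\<^bsub>A'\<^esub>k \<in> {k \<in> carrier G. g' k \<noteq> \<zero>\<^bsub>A'\<^esub>}. g' k)"
      let ?I = "{k \<in> carrier G. g' k \<noteq> \<zero>\<^bsub>A'\<^esub>}"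
      have "\<forall>k \<in> carrier G. \<exists>y. y \<in> grade A k \<and> g' k = \<phi> y"
        using g' by (auto simp: grade PiE_iff)
      then obtain g where g: "g k \<in> grade A k" "g' k = \<phi> (g k)" if "k \<in> carrier G" for k
        by metis
      have gc: "g k \<in> carrier A" if "k \<in> carrier G" for k
        using g(1) grade_closed that by blast
      have "\<phi> x = (\<Oplus>\<^bsub>A'\<^esub>k \<in> ?I. g' k)"
        using g' x by simp
      also have "\<dots> = (\<Oplus>\<^bsub>A'\<^esub>k \<in> ?I. \<phi> (g k))"
        using gc g by (intro A'.finsum_cong') (auto simp: carrier)
      also have "\<dots> = \<phi> (\<Oplus>k \<in> ?I. g k)"
        using gc by (intro sum[symmetric]) auto
      finally have x_eq: "x = (\<Oplus>k \<in> ?I. g k)"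
        using x(1) gc by (subst (asm) inj) (auto intro!: A.finsum_closed)
      have "g' k = f' k" if k: "k \<in> carrier G" for k
      proof -
        have "?c k = (if k \<in> ?I then g k else \<zero>)"
          unfolding x_eq using g(1) g' k by (intro component_sum) auto
        then show ?thesis
          using k g(2)[OF k] by (auto simp: f'_def)
      qed
      moreover have "g' \<in> extensional (carrier G)"
        using g' by (auto simp: PiE_iff)
      ultimately show "g' = f'"
        by (intro extensionalityI[of g' "carrier G" f']) (simp_all add: f'_def)
    qed
  next
    show "base_emb A' \<in> alg_hom K B A'"
      by (rule alg_homI) (simp_all add: emb base_emb_hom base_emb_in_carrier carrier)
    show "bij_betw (base_emb A') (carrier B) (grade A' \<one>\<^bsub>G\<^esub>)"
    proof (rule bij_betw_imageI)
      show "inj_on (base_emb A') (carrier B)"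
        by (rule inj_onI) (simp add: emb inj base_emb_in_carrier base_emb_eq_iff)
      have "base_emb A' ` carrier B = \<phi> ` (base_emb A ` carrier B)"
        by (simp add: emb image_image)
      then show "base_emb A' ` carrier B = grade A' \<one>\<^bsub>G\<^esub>"
        using A.base_bij by (simp add: grade bij_betw_def)
    qed
  qed
  then show "graded_bundle K G B A'"
    by (intro graded_bundle.intro bundle_base_axioms)
  show "bundle_iso K G B \<phi> A A'"
    using hom bij by (simp add: bundle_iso_def grade emb)
qed

text \<open>
  The operations on the image of \<open>e\<close> are those of \<open>A\<close>, carried along \<open>e\<close>.  The crossed product has
  functions as elements; this puts a copy of it on a prescribed type.
\<close>
lemma bundle_transport:
  fixes e :: "'a \<Rightarrow> 'c"
  assumes "inj_on e (carrier A)"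
  obtains A' where "graded_bundle K G B A'" "bundle_iso K G B e A A'"
proof -
  let ?r = "inv_into (carrier A) e"
  let ?A' = "\<lparr>carrier = e ` carrier A, mult = (\<lambda>x y. e (?r x \<otimes> ?r y)), one = e \<one>,
     zero = e \<zero>, add = (\<lambda>x y. e (?r x \<oplus> ?r y)), smult = (\<lambda>a x. e (a \<odot> ?r x)),
     grade = (\<lambda>k. e ` grade A k), base_emb = e \<circ> base_emb A\<rparr>"
  have "bij_betw e (carrier A) (carrier ?A')"
    using assms by (simp add: bij_betw_def)
  then show thesis
    using assms by (intro that[of ?A'] bundle_transfer) simp_all
qed

text \<open>
  The isomorphism sends a family \<open>f\<close> to the sum of the elements \<open>f k\<close> times \<open>\<sigma> k\<close>.  On monomials it is
  multiplicative because \<open>\<sigma>\<close> satisfies the relations that define the convolution; it is bijective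
  because each homogeneous component has a unique coefficient with respect to \<open>\<sigma>\<close>.
\<close>
lemma crossed_product_iso:
  assumes \<sigma>: "\<sigma> \<in> homogeneous_sections G A"
    and eq: "section_factor_system G B A \<sigma> = (S, \<omega>)"
  obtains \<Phi> where "bundle_iso K G B \<Phi> (crossed_product_data.crossed_product G B S \<omega>) A"
proof -
  interpret X: crossed_product_data K G B S \<omega>
    using section_factor_system_in_factor_systems[OF \<sigma>] eq
    by (intro crossed_product_data.intro bundle_base_axioms crossed_product_data_axioms.intro) simp
  note D = section_factor_systemD[OF \<sigma> eq] and s = homogeneous_sectionD[OF \<sigma>]
  let ?C = "X.crossed_product" and ?j = "base_emb A"
  note [simp] = s(2,3,4) base_emb_in_carrier
  have j_zero [simp]: "?j \<zero>\<^bsub>B\<^esub> = \<zero>"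
    using base_emb_hom(1)[of "\<zero>\<^bsub>B\<^esub>" "\<zero>\<^bsub>B\<^esub>"] by simp
  define \<Phi> where "\<Phi> f = (\<Oplus>k \<in> {k \<in> carrier G. f k \<noteq> \<zero>\<^bsub>B\<^esub>}. ?j (f k) \<otimes> \<sigma> k)" for f
  have supp: "finite {k \<in> carrier G. f k \<noteq> \<zero>\<^bsub>B\<^esub>}" if "f \<in> carrier ?C" for f
    using that X.familyD(3) by (simp add: X.crossed_product_def)
  have term_closed: "?j (f k) \<otimes> \<sigma> k \<in> carrier A" if "f \<in> carrier ?C" "k \<in> carrier G" for f k
    using that X.apply_closed by simp
  have \<Phi>_eq: "\<Phi> f = (\<Oplus>k \<in> I. ?j (f k) \<otimes> \<sigma> k)"
    if f: "f \<in> carrier ?C" and I: "finite I" "I \<subseteq> carrier G" "{k \<in> carrier G. f k \<noteq> \<zero>\<^bsub>B\<^esub>} \<subseteq> I" for f I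
    unfolding \<Phi>_def using I term_closed[OF f]
    by (intro A.add.finprod_mono_neutral_cong_right[symmetric]) (auto simp: subset_iff)
  have \<Phi>_closed: "\<Phi> f \<in> carrier A" if "f \<in> carrier ?C" for f
    unfolding \<Phi>_def using term_closed[OF that] by (intro A.finsum_closed) auto
  have \<Phi>_single: "\<Phi> (X.single b k) = ?j b \<otimes> \<sigma> k" if "b \<in> carrier B" "k \<in> carrier G" for b k
  proof -
    have "{l \<in> carrier G. X.single b k l \<noteq> \<zero>\<^bsub>B\<^esub>} \<subseteq> {k}"
      by (auto simp: X.apply_single split: if_splits)
    then show ?thesis
      using that \<Phi>_eq[of "X.single b k" "{k}"] by (simp add: X.single_closed X.apply_single)
  qed
  have \<Phi>_add: "\<Phi> (f \<oplus>\<^bsub>?C\<^esub> g) = \<Phi> f \<oplus> \<Phi> g" if f: "f \<in> carrier ?C" and g: "g \<in> carrier ?C" for f g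
  proof -
    let ?I = "{k \<in> carrier G. f k \<noteq> \<zero>\<^bsub>B\<^esub>} \<union> {k \<in> carrier G. g k \<noteq> \<zero>\<^bsub>B\<^esub>}"
    have I: "finite ?I" "?I \<subseteq> carrier G"
      using supp[OF f] supp[OF g] by auto
    have "\<Phi> (f \<oplus>\<^bsub>?C\<^esub> g) = (\<Oplus>k \<in> ?I. ?j ((f \<oplus>\<^bsub>?C\<^esub> g) k) \<otimes> \<sigma> k)"
      using f g I by (intro \<Phi>_eq X.add_family) (auto simp: X.apply_add)
    also have "\<dots> = (\<Oplus>k \<in> ?I. ?j (f k) \<otimes> \<sigma> k \<oplus> ?j (g k) \<otimes> \<sigma> k)"
      using f g by (intro A.finsum_cong')
        (auto simp: X.apply_add X.apply_closed base_emb_hom A.l_distr)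
    also have "\<dots> = (\<Oplus>k \<in> ?I. ?j (f k) \<otimes> \<sigma> k) \<oplus> (\<Oplus>k \<in> ?I. ?j (g k) \<otimes> \<sigma> k)"
      using f g term_closed by (intro A.finsum_addf) auto
    also have "\<dots> = \<Phi> f \<oplus> \<Phi> g"
      using \<Phi>_eq[OF f I] \<Phi>_eq[OF g I] by auto
    finally show ?thesis .
  qed
  have \<Phi>_smult: "\<Phi> (a \<odot>\<^bsub>?C\<^esub> f) = a \<odot> \<Phi> f" if a: "a \<in> carrier K" and f: "f \<in> carrier ?C" for a f
    using f
  proof (induction f rule: X.family_induct)
    case (single b k)
    then show ?case
      using a by (simp add: X.single_smult \<Phi>_single base_emb_hom A.smult_mult_left)
  next
    case (add f g)
    then show ?case
      using a by (simp add: X.X.A.smult_r_distr A.smult_r_distr \<Phi>_add \<Phi>_closed)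
  qed
  have \<Phi>_mult: "\<Phi> (f \<otimes>\<^bsub>?C\<^esub> g) = \<Phi> f \<otimes> \<Phi> g" if f: "f \<in> carrier ?C" and g: "g \<in> carrier ?C" for f g
    using f
  proof (induction f rule: X.family_induct)
    case (single b k)
    note b = single
    show ?case
      using g
    proof (induction g rule: X.family_induct)
      case (single c l)
      have "?j (b \<otimes>\<^bsub>B\<^esub> S k c \<otimes>\<^bsub>B\<^esub> \<omega> (k, l)) \<otimes> \<sigma> (k \<otimes>\<^bsub>G\<^esub> l) = ?j b \<otimes> (?j (S k c) \<otimes> \<sigma> k) \<otimes> \<sigma> l"
        using b single D(4)[of k l] by (simp add: base_emb_hom A.m_assoc)
      also have "\<dots> = ?j b \<otimes> \<sigma> k \<otimes> (?j c \<otimes> \<sigma> l)"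
        using b single D(2)[of k c] by (simp add: A.m_assoc)
      finally show ?case
        using b single by (simp add: X.single_mult_single \<Phi>_single)
    next
      case (add g h)
      then show ?case
        using b by (simp add: X.X.A.r_distr A.r_distr \<Phi>_add \<Phi>_closed X.single_closed)
    qed
  next
    case (add f h)
    then show ?case
      using g by (simp add: X.X.A.l_distr A.l_distr \<Phi>_add \<Phi>_closed)
  qed
  have \<Phi>_component: "component (\<Phi> f) k = ?j (f k) \<otimes> \<sigma> k" if f: "f \<in> carrier ?C" and k: "k \<in> carrier G" for f k
  proof -
    have "component (\<Phi> f) k = (if k \<in> {k \<in> carrier G. f k \<noteq> \<zero>\<^bsub>B\<^esub>} then ?j (f k) \<otimes> \<sigma> k else \<zero>)"
      unfolding \<Phi>_def using supp[OF f] k s(1) X.apply_closed[OF f]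
      by (intro component_sum) (auto intro!: base_emb_mult_in_grade)
    then show ?thesis
      using k by auto
  qed
  have \<Phi>_inj: "inj_on \<Phi> (carrier ?C)"
  proof (rule inj_onI)
    fix f g assume f: "f \<in> carrier ?C" and g: "g \<in> carrier ?C" and "\<Phi> f = \<Phi> g"
    then show "f = g"
      using \<Phi>_component[OF f] \<Phi>_component[OF g] X.apply_closed
      by (intro X.crossed_product_eqI) (metis base_emb_mult_Units_cancel s(2))+
  qed
  have \<Phi>_surj: "x \<in> \<Phi> ` carrier ?C" if x: "x \<in> carrier A" for x
  proof -
    \<comment> \<open>the coefficients of the components of \<open>x\<close>\<close>
    define f where "f = (\<lambda>k \<in> carrier G. inv_into (carrier B) ?j (component x k \<otimes> inv \<sigma> k))"
    let ?I = "{k \<in> carrier G. component x k \<noteq> \<zero>}"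
    have f: "f k \<in> carrier B" "?j (f k) \<otimes> \<sigma> k = component x k" if "k \<in> carrier G" for k
      using homogeneous_coefficient[OF that s(1,2) component_in_grade[OF x]] that by (auto simp: f_def)
    have d: "finite ?I" "x = (\<Oplus>k \<in> ?I. component x k)"
      using decomposes_component[OF x] by blast+
    have "f k = \<zero>\<^bsub>B\<^esub>" if k: "k \<in> carrier G" "component x k = \<zero>" for k
    proof -
      have "?j (f k) \<otimes> \<sigma> k = ?j \<zero>\<^bsub>B\<^esub> \<otimes> \<sigma> k"
        using f k by simp
      then show ?thesis
        using base_emb_mult_Units_cancel[OF s(2)[OF k(1)] f(1)[OF k(1)] B.zero_closed] by simp
    qed
    then have sub: "{k \<in> carrier G. f k \<noteq> \<zero>\<^bsub>B\<^esub>} \<subseteq> ?I"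
      by auto
    have "f \<in> extensional (carrier G)"
      by (simp add: f_def)
    then have fC: "f \<in> carrier ?C"
      using f(1) finite_subset[OF sub d(1)]
      by (simp add: X.crossed_product_def finsupp_families_def PiE_iff)
    have "\<Phi> f = (\<Oplus>k \<in> ?I. ?j (f k) \<otimes> \<sigma> k)"
      using d(1) sub by (intro \<Phi>_eq[OF fC]) auto
    also have "\<dots> = (\<Oplus>k \<in> ?I. component x k)"
      using f component_in_grade[OF x] grade_closed by (intro A.finsum_cong') auto
    finally show ?thesis
      using d(2) fC by (metis imageI)
  qed
  have "bundle_iso K G B \<Phi> ?C A"
    unfolding bundle_iso_def
  proof (intro conjI ballI)
    show "\<Phi> \<in> alg_hom K ?C A"
    proof (rule alg_homI)
      have "\<one>\<^bsub>?C\<^esub> = X.single \<one>\<^bsub>B\<^esub> \<one>\<^bsub>G\<^esub>"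
        by (simp add: X.crossed_product_def)
      then show "\<Phi> \<one>\<^bsub>?C\<^esub> = \<one>"
        by (simp add: \<Phi>_single base_emb_hom)
    qed (simp_all add: \<Phi>_closed \<Phi>_add \<Phi>_mult \<Phi>_smult)
    show "bij_betw \<Phi> (carrier ?C) (carrier A)"
      using \<Phi>_inj \<Phi>_surj \<Phi>_closed by (auto simp: bij_betw_def)
    fix k assume k: "k \<in> carrier G"
    have "\<Phi> ` grade ?C k = (\<lambda>b. ?j b \<otimes> \<sigma> k) ` carrier B"
      using k by (auto simp: X.crossed_product_def image_image \<Phi>_single)
    also have "\<dots> = grade A k"
      using k base_emb_mult_in_grade s(1) homogeneous_coefficient(1,2)[OF k s(1,2)]
      by (auto simp: image_iff) metis
    finally show "\<Phi> ` grade ?C k = grade A k" .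
  next
    fix b assume "b \<in> carrier B"
    then show "\<Phi> (base_emb ?C b) = ?j b"
      by (simp add: X.crossed_product_def \<Phi>_single)
  qed
  then show thesis
    by (rule that)
qed

end


section \<open>The characteristic class as a bijection\<close>

lemma bundle_rel_iff:
  assumes "bundle_base K G B"
  shows "(A, A') \<in> bundle_rel K G B \<longleftrightarrow>
    graded_bundle K G B A \<and> graded_bundle K G B A' \<and> (\<exists>\<phi>. bundle_iso K G B \<phi> A A')"
  using assms
  by (auto simp: bundle_rel_def trivial_bundles_def bundle_iso_def graded_bundle_def)

lemma trivial_bundles_iff:
  assumes "bundle_base K G B"
  shows "A \<in> trivial_bundles K G B \<longleftrightarrow> graded_bundle K G B A"
  using assms by (auto simp: trivial_bundles_def graded_bundle_def)

context bundle_base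
begin

lemma bundle_rel_equiv: "equiv (trivial_bundles K G B) (bundle_rel K G B)"
proof (rule equivI)
  show "bundle_rel K G B \<subseteq> trivial_bundles K G B \<times> trivial_bundles K G B"
    by (auto simp: bundle_rel_def)
  show "refl_on (trivial_bundles K G B) (bundle_rel K G B)"
    by (rule refl_onI)
      (auto simp: bundle_rel_iff[OF bundle_base_axioms] trivial_bundles_iff[OF bundle_base_axioms]
        intro: graded_bundle.bundle_iso_refl)
  show "sym (bundle_rel K G B)"
    by (rule symI) (auto simp: bundle_rel_iff[OF bundle_base_axioms] dest: graded_bundle.bundle_iso_sym)
  show "trans (bundle_rel K G B)"
    by (rule transI)
      (auto simp: bundle_rel_iff[OF bundle_base_axioms] dest: graded_bundle.bundle_iso_trans)
qed

lemma char_class_respects: "char_class K G B respects bundle_rel K G B"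
  by (rule congruentI)
    (auto simp: bundle_rel_iff[OF bundle_base_axioms] dest: graded_bundle.bundle_iso_char_class)

lemma char_class_in_H2:
  assumes "graded_bundle K G B A"
  shows "char_class K G B A \<in> H2 K G B"
proof -
  interpret graded_bundle K G B A by fact
  obtain \<sigma> where \<sigma>: "\<sigma> \<in> homogeneous_sections G A"
    using homogeneous_sections_nonempty by blast
  then show ?thesis
    using cohomology_class_section_factor_system[OF \<sigma>] section_factor_system_in_factor_systems[OF \<sigma>]
    unfolding H2_def char_class_eq by (metis imageI)
qed

text \<open>
  If the characteristic classes agree, then some sections of \<open>A\<close> and \<open>A'\<close> have the same factor
  system, and both bundles are isomorphic to its crossed product.
\<close>
lemma bundle_iso_if_char_class_eq:
  fixes A :: "('k, 'a, 'g, 'b) ncp_bundle" and A' :: "('k, 'c, 'g, 'b) ncp_bundle"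
  assumes A: "graded_bundle K G B A" and A': "graded_bundle K G B A'"
    and eq: "char_class K G B A = char_class K G B A'"
  shows "\<exists>\<phi>. bundle_iso K G B \<phi> A A'"
proof -
  interpret A: graded_bundle K G B A by fact
  interpret A': graded_bundle K G B A' by fact
  obtain \<sigma> where \<sigma>: "\<sigma> \<in> homogeneous_sections G A"
    using A.homogeneous_sections_nonempty by blast
  obtain S \<omega> where fs: "section_factor_system G B A \<sigma> = (S, \<omega>)"
    by fastforce
  then have "(S, \<omega>) \<in> char_class K G B A'"
    using \<sigma> unfolding eq[symmetric] A.char_class_eq by (metis imageI)
  then obtain \<tau> where \<tau>: "\<tau> \<in> homogeneous_sections G A'" "section_factor_system G B A' \<tau> = (S, \<omega>)"
    unfolding A'.char_class_eq by auto
  interpret X: crossed_product_data K G B S \<omega>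
    using A.section_factor_system_in_factor_systems[OF \<sigma>] fs
    by (intro crossed_product_data.intro bundle_base_axioms crossed_product_data_axioms.intro) simp
  obtain \<Phi> \<Psi> where "bundle_iso K G B \<Phi> X.C A" "bundle_iso K G B \<Psi> X.C A'"
    using A.crossed_product_iso[OF \<sigma> fs] A'.crossed_product_iso[OF \<tau>] by metis
  then show ?thesis
    using A.bundle_iso_trans X.X.bundle_iso_sym by blast
qed

text \<open>
  The crossed product has the prescribed class.  Its elements are the finitely supported families in
  \<open>B\<close>, so the injection \<open>emb\<close> moves it to the type \<open>'a\<close>.
\<close>
lemma bundle_with_char_class:
  fixes emb :: "('g \<Rightarrow> 'b) \<Rightarrow> 'a"
  assumes emb: "inj_on emb (finsupp_families G B)" and s: "s \<in> factor_systems K G B"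
  shows "\<exists>A :: ('k, 'a, 'g, 'b) ncp_bundle.
    graded_bundle K G B A \<and> char_class K G B A = cohomology_class K G B s"
proof -
  obtain S \<omega> where S\<omega>: "s = (S, \<omega>)"
    by fastforce
  interpret X: crossed_product_data K G B S \<omega>
    using s S\<omega> by (intro crossed_product_data.intro bundle_base_axioms crossed_product_data_axioms.intro) simp
  have "inj_on emb (carrier X.C)"
    using emb by (simp add: X.crossed_product_def)
  then obtain A where A: "graded_bundle K G B A" "bundle_iso K G B emb X.C A"
    by (rule X.X.bundle_transport)
  have "char_class K G B A = char_class K G B X.C"
    using X.X.bundle_iso_char_class[OF A(2,1)] ..
  also have "\<dots> = cohomology_class K G B s"
    using X.X.cohomology_class_section_factor_system[OF X.crossed_product_section(1)]
    by (simp add: X.X.char_class_eq X.crossed_product_section(2) S\<omega>)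
  finally show ?thesis
    using A(1) by blast
qed

lemma chi_class:
  assumes A: "graded_bundle K G B A"
  shows "chi K G B (bundle_rel K G B `` {A}) = char_class K G B A"
proof -
  have "A \<in> bundle_rel K G B `` {A}"
    using A by (intro equiv_class_self[OF bundle_rel_equiv]) (simp add: trivial_bundles_iff[OF bundle_base_axioms])
  moreover have "char_class K G B A' = char_class K G B A" if "A' \<in> bundle_rel K G B `` {A}" for A'
    using that congruentD[OF char_class_respects, of A A'] by simp
  then have "char_class K G B ` (bundle_rel K G B `` {A}) = (\<lambda>_. char_class K G B A) ` (bundle_rel K G B `` {A})"
    by (intro image_cong refl)
  ultimately have "char_class K G B ` (bundle_rel K G B `` {A}) = {char_class K G B A}"
    by (simp only: image_constant)
  then show ?thesis
    by (simp add: chi_def)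
qed

lemma chi_bij_betw:
  fixes emb :: "('g \<Rightarrow> 'b) \<Rightarrow> 'a"
  assumes emb: "inj_on emb (finsupp_families G B)"
  shows "bij_betw (chi K G B) (Ext K G B :: ('k, 'a, 'g, 'b) ncp_bundle set set) (H2 K G B)"
proof (rule bij_betw_imageI)
  let ?E = "Ext K G B :: ('k, 'a, 'g, 'b) ncp_bundle set set"
  have Ext: "?E = (\<lambda>A. bundle_rel K G B `` {A}) ` {A. graded_bundle K G B A}"
    by (auto simp: Ext_def quotient_def trivial_bundles_iff[OF bundle_base_axioms])
  show "inj_on (chi K G B) ?E"
  proof (rule inj_onI)
    fix X Y assume "X \<in> ?E" "Y \<in> ?E" and chi: "chi K G B X = chi K G B Y"
    then obtain A A' where A: "graded_bundle K G B A" "X = bundle_rel K G B `` {A}"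
      and A': "graded_bundle K G B A'" "Y = bundle_rel K G B `` {A'}"
      unfolding Ext by blast
    have "(A, A') \<in> bundle_rel K G B"
      using bundle_iso_if_char_class_eq[OF A(1) A'(1)] chi A A'
      by (simp add: chi_class bundle_rel_iff[OF bundle_base_axioms])
    then show "X = Y"
      using equiv_class_eq[OF bundle_rel_equiv] A(2) A'(2) by blast
  qed
  have "chi K G B ` ?E = char_class K G B ` {A :: ('k, 'a, 'g, 'b) ncp_bundle. graded_bundle K G B A}"
    unfolding Ext image_image by (intro image_cong) (simp_all add: chi_class)
  also have "\<dots> = H2 K G B"
  proof
    show "char_class K G B ` {A :: ('k, 'a, 'g, 'b) ncp_bundle. graded_bundle K G B A} \<subseteq> H2 K G B"
      using char_class_in_H2 by blast
    show "H2 K G B \<subseteq> char_class K G B ` {A :: ('k, 'a, 'g, 'b) ncp_bundle. graded_bundle K G B A}"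
    proof
      fix c assume "c \<in> H2 K G B"
      then obtain s where s: "s \<in> factor_systems K G B" "c = cohomology_class K G B s"
        unfolding H2_def by blast
      obtain A :: "('k, 'a, 'g, 'b) ncp_bundle"
        where "graded_bundle K G B A" "char_class K G B A = cohomology_class K G B s"
        using bundle_with_char_class[OF emb s(1)] by blast
      then show "c \<in> char_class K G B ` {A :: ('k, 'a, 'g, 'b) ncp_bundle. graded_bundle K G B A}"
        using s(2) by blast
    qed
  qed
  finally show "chi K G B ` ?E = H2 K G B" .
qed

end

lemma Zn_group: "group (Zn n)"
  by (simp add: Zn_def)

theorem theorem7p3p20:
  fixes K :: "('k, 'm) ring_scheme"
    and B :: "('k, 'b, 'y) module_scheme"
    and n :: nat
    and emb :: "((nat \<Rightarrow> int) \<Rightarrow> 'b) \<Rightarrow> 'a"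
  assumes "field K"
    and "unital_algebra K B"
    and large_universe: "inj_on emb (finsupp_families (Zn n) B)"
  shows "(\<forall>A \<in> (trivial_bundles K (Zn n) B :: ('k, 'a, nat \<Rightarrow> int, 'b) ncp_bundle set).
            homogeneous_sections (Zn n) A \<noteq> {} \<and>
            (\<forall>\<sigma> \<in> homogeneous_sections (Zn n) A.
               section_factor_system (Zn n) B A \<sigma> \<in> factor_systems K (Zn n) B \<and>
               cohomology_class K (Zn n) B (section_factor_system (Zn n) B A \<sigma>)
                 = char_class K (Zn n) B A))
       \<and> char_class K (Zn n) B respects
            (bundle_rel K (Zn n) B :: ('k, 'a, nat \<Rightarrow> int, 'b) ncp_bundle rel)
       \<and> (\<forall>A \<in> (trivial_bundles K (Zn n) B :: ('k, 'a, nat \<Rightarrow> int, 'b) ncp_bundle set).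
            chi K (Zn n) B (bundle_rel K (Zn n) B `` {A}) = char_class K (Zn n) B A)
       \<and> bij_betw (chi K (Zn n) B)
            (Ext K (Zn n) B :: ('k, 'a, nat \<Rightarrow> int, 'b) ncp_bundle set set)
            (H2 K (Zn n) B)"
proof -
  interpret base: bundle_base K "Zn n" B
    using Zn_group assms(2) by (rule bundle_base.intro)
  note bundles = trivial_bundles_iff[OF base.bundle_base_axioms]
  show ?thesis
  proof (intro conjI ballI)
    fix A :: "('k, 'a, nat \<Rightarrow> int, 'b) ncp_bundle"
    assume A: "A \<in> trivial_bundles K (Zn n) B"
    interpret graded_bundle K "Zn n" B A
      using A by (simp add: bundles)
    show "homogeneous_sections (Zn n) A \<noteq> {}"
      by (rule homogeneous_sections_nonempty)
    show "chi K (Zn n) B (bundle_rel K (Zn n) B `` {A}) = char_class K (Zn n) B A"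
      by (rule base.chi_class) (rule graded_bundle_axioms)
    fix \<sigma> assume \<sigma>: "\<sigma> \<in> homogeneous_sections (Zn n) A"
    show "section_factor_system (Zn n) B A \<sigma> \<in> factor_systems K (Zn n) B"
      using \<sigma> by (rule section_factor_system_in_factor_systems)
    show "cohomology_class K (Zn n) B (section_factor_system (Zn n) B A \<sigma>) = char_class K (Zn n) B A"
      using cohomology_class_section_factor_system[OF \<sigma>] by (simp only: char_class_eq)
  qed (rule base.char_class_respects base.chi_bij_betw[OF large_universe])+
qed

end
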